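(* Let $n\ge2$, $p\in\{2,\dots,n\}$, $c,d\in\mathbb{R}$, let $M,K$ be symmetric positive definite $n\times n$ real matrices, and let $\omega_k>0$, $\phi_k\in\mathbb{R}^n$ $(k=1,\dots,n)$ satisfy $K\phi_k=\omega_k^2M\phi_k$ and $\phi_k^TM\phi_l=\delta_{kl}$, with $\omega_k$ and $\omega_1$ $\mathbb{Z}$-independent for each $k\neq1$. Let $\lambda_k>0$, $f_k\in\mathbb{R}$ with $f_1>0$, and put $\tilde d=d(\phi_{1,p}-\phi_{1,p-1})^4$. For $\sigma\in\mathbb{R}$, a stationary solution $(a_1,\beta_1)$, with amplitude $a_1>0$, of $$\omega_1\Bigl(2\frac{da_1}{dT_1}+\lambda_1a_1\Bigr)=-f_1\sin\beta_1,\qquad2\omega_1\Bigl(a_1\frac{d\beta_1}{dT_1}+\sigma a_1\Bigr)=\frac{3\tilde d\,a_1^3}{4}-f_1\cos\beta_1$$ satisfies $$\lambda_1a_1\omega_1+f_1\sin\beta_1=0,\qquad2a_1\omega_1\sigma-\frac{3\tilde d\,a_1^3}{4}+f_1\cos\beta_1=0.$$ As $\sigma$ varies, it reaches its maximum amplitude for $\sigma=\frac{3\tilde d\,a_1^2}{8\omega_1}$ and $\beta_1=\frac\pi2+k\pi$ (for some integer $k$); the excitation is then at the frequency $$\tilde\omega_\epsilon=\omega_1+3\epsilon\frac{\tilde d\,a_1^2}{8\omega_1},\qquad\text{and}\qquad f_1=\lambda_1\omega_1a_1.$$ This $\tilde\omega_\epsilon$ is the frequency of the free periodic solution. For this frequency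 the approximation (up to order $\epsilon$) of the solution $(y_1,\dots,y_n)$ of $$\ddot y_k+\epsilon\lambda_k\dot y_k+\omega_k^2y_k+\delta_p\phi_k\left[c\Bigl(\sum_{i=1}^ny_i\,\delta_p\phi_i\Bigr)^2+\frac d\epsilon\Bigl(\sum_{i=1}^ny_i\,\delta_p\phi_i\Bigr)^3\right]=\epsilon^2f_k\cos(\tilde\omega_\epsilon t),\quad k=1,\dots,n,$$ whose initial data are those of this stationary solution up to $O(\epsilon^2)$, is periodic: $$y_1(t)=\epsilon\frac{f_1}{\lambda_1\omega_1}\sin(\tilde\omega_\epsilon t)+\epsilon^2r_1(\epsilon,t),\qquad y_k(t)=\epsilon^2r_k(\epsilon,t)\ (k\neq1),$$ with $r_k(\epsilon,\cdot)$ uniformly bounded in $C^2(0,\gamma/\epsilon)$, $k=1,\dots,n$, for some $\gamma>0$ and all sufficiently small $\epsilon>0$.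
   Context: $T_1=\epsilon t$ is the slow time and $\tilde\omega_\epsilon=\omega_1+\epsilon\sigma$ is the excitation frequency. $\phi_{k,j}$ is the $j$-th component of $\phi_k$ and $\delta_p\phi_k=\phi_{k,p}-\phi_{k,p-1}$. $\mathbb{Z}$-independence of $\omega_k$ and $\omega_1$ means that $m\omega_k+q\omega_1=0$ with $m,q\in\mathbb{Z}$ forces $m=q=0$. To a stationary solution $(a_1,\beta_1)$ corresponds the approximate solution $y_1\approx\epsilon a_1\cos(\tilde\omega_\epsilon t+\beta_1)$; "initial data of the stationary solution up to $O(\epsilon^2)$" means $y_1(0)=\epsilon a_1\cos\beta_1+O(\epsilon^2)$, $\dot y_1(0)=-\epsilon\omega_1a_1\sin\beta_1+O(\epsilon^2)$, $y_k(0)=O(\epsilon^2)$, $\dot y_k(0)=0$ for $k\ne1$. "The free periodic solution" refers to the approximation $y_1\approx\epsilon a_1\cos(\nu_\epsilon t)$, $\nu_\epsilon=\omega_1+3\epsilon\frac{d\,a_1^2}{8\omega_1}(\phi_{1,p}-\phi_{1,p-1})^4$, of the solution with amplitude $a_1$ of the same system without damping and forcing ($\lambda_k=0$, $f_k=0$). "Uniformly bounded in $C^2(0,\gamma/\epsilon)$" means that $|r_k|,|\partial_tr_k|,|\partial_t^2r_k|$ are bounded on $(0,\gamma/\epsilon)$ by a constant independent of $\epsilon$. *)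

theory Defs
  imports Complex_Main "HOL-Library.Landau_Symbols" "Jordan_Normal_Form.Matrix"
begin

definition sym_pos_def :: "nat \<Rightarrow> real Matrix.mat \<Rightarrow> bool" where
  "sym_pos_def n A \<longleftrightarrow> A \<in> carrier_mat n n \<and> transpose_mat A = A \<and>
     (\<forall>v \<in> carrier_vec n. v \<noteq> 0\<^sub>v n \<longrightarrow> scalar_prod v (A *\<^sub>v v) > 0)"

definition int_independent :: "real \<Rightarrow> real \<Rightarrow> bool" where
  "int_independent x y \<longleftrightarrow>
     (\<forall>m q :: int. of_int m * x + of_int q * y = 0 \<longrightarrow> m = 0 \<and> q = 0)"

text \<open>The jump \<open>\<delta>\<^sub>p v = v\<^sub>p - v\<^bsub>p-1\<^esub>\<close> for \<open>p \<ge> 2\<close>. Components are numbered from 1 in the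
  mathematics and from 0 in vectors here, so \<open>v\<^sub>j\<close> is the entry at index \<open>j - 1\<close>.\<close>

definition jump :: "nat \<Rightarrow> real Matrix.vec \<Rightarrow> real" where
  "jump p v = vec_index v (p - 1) - vec_index v (p - 2)"

text \<open>Amplitude \<open>A\<close> and phase \<open>B\<close> as functions of the slow time; \<open>l\<close>, \<open>f\<close>, \<open>w\<close> stand for
  \<open>\<lambda>\<^sub>1\<close>, \<open>f\<^sub>1\<close>, \<open>\<omega>\<^sub>1\<close> and \<open>dt\<close> for \<open>d (\<phi>\<^bsub>1,p\<^esub> - \<phi>\<^bsub>1,p-1\<^esub>)\<^sup>4\<close>.\<close>

definition modulation_solution ::
  "real \<Rightarrow> real \<Rightarrow> real \<Rightarrow> real \<Rightarrow> real \<Rightarrow> (real \<Rightarrow> real) \<Rightarrow> (real \<Rightarrow> real) \<Rightarrow> bool" where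
  "modulation_solution w l f dt \<sigma> A B \<longleftrightarrow> (\<exists>A' B'. \<forall>T.
     (A has_real_derivative A' T) (at T) \<and> (B has_real_derivative B' T) (at T) \<and>
     w * (2 * A' T + l * A T) = - f * sin (B T) \<and>
     2 * w * (A T * B' T + \<sigma> * A T) = 3 * dt * A T ^ 3 / 4 - f * cos (B T))"

definition stationary_solution ::
  "real \<Rightarrow> real \<Rightarrow> real \<Rightarrow> real \<Rightarrow> real \<Rightarrow> real \<Rightarrow> real \<Rightarrow> bool" where
  "stationary_solution w l f dt \<sigma> a \<beta> \<longleftrightarrow>
     a > 0 \<and> modulation_solution w l f dt \<sigma> (\<lambda>_. a) (\<lambda>_. \<beta>)"

text \<open>The maximum is over all stationary solutions for all detunings \<open>\<sigma>\<close>.\<close>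

definition max_amplitude_solution ::
  "real \<Rightarrow> real \<Rightarrow> real \<Rightarrow> real \<Rightarrow> real \<Rightarrow> real \<Rightarrow> real \<Rightarrow> bool" where
  "max_amplitude_solution w l f dt \<sigma> a \<beta> \<longleftrightarrow>
     stationary_solution w l f dt \<sigma> a \<beta> \<and>
     (\<forall>\<sigma>' a' \<beta>'. stationary_solution w l f dt \<sigma>' a' \<beta>' \<longrightarrow> a' \<le> a)"

definition excitation_freq :: "real \<Rightarrow> real \<Rightarrow> real \<Rightarrow> real" where
  "excitation_freq w \<sigma> \<epsilon> = w + \<epsilon> * \<sigma>"

definition stationary_approx :: "real \<Rightarrow> real \<Rightarrow> real \<Rightarrow> real \<Rightarrow> real \<Rightarrow> real \<Rightarrow> real" where
  "stationary_approx w \<sigma> a \<beta> \<epsilon> t = \<epsilon> * a * cos (excitation_freq w \<sigma> \<epsilon> * t + \<beta>)"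

text \<open>Approximation of the periodic solution of amplitude \<open>a\<close> of the system without damping
  and forcing; \<open>h\<close> stands for \<open>\<phi>\<^bsub>1,p\<^esub> - \<phi>\<^bsub>1,p-1\<^esub>\<close>.\<close>

definition free_freq :: "real \<Rightarrow> real \<Rightarrow> real \<Rightarrow> real \<Rightarrow> real \<Rightarrow> real" where
  "free_freq w d h a \<epsilon> = w + 3 * \<epsilon> * (d * a ^ 2 / (8 * w)) * h ^ 4"

definition free_approx :: "real \<Rightarrow> real \<Rightarrow> real \<Rightarrow> real \<Rightarrow> real \<Rightarrow> real \<Rightarrow> real" where
  "free_approx w d h a \<epsilon> t = \<epsilon> * a * cos (free_freq w d h a \<epsilon> * t)"

text \<open>\<open>x\<close> is periodic with least positive period \<open>2\<pi>/\<Omega>\<close>.\<close>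

definition has_angular_freq :: "(real \<Rightarrow> real) \<Rightarrow> real \<Rightarrow> bool" where
  "has_angular_freq x \<Omega> \<longleftrightarrow> \<Omega> > 0 \<and> (\<forall>t. x (t + 2 * pi / \<Omega>) = x t) \<and>
     (\<forall>T. 0 < T \<and> T < 2 * pi / \<Omega> \<longrightarrow> (\<exists>t. x (t + T) \<noteq> x t))"

text \<open>Solution on \<open>[0,T]\<close> of the forced damped system in modal coordinates, with modal jumps
  \<open>h k = \<delta>\<^sub>p \<phi>\<^sub>k\<close>, driving frequency \<open>\<Omega>\<close>, and initial positions \<open>y0\<close> and velocities \<open>v0\<close>.
  Only the components \<open>k \<in> {1..n}\<close> are constrained.\<close>

definition forced_solution_on ::
  "real \<Rightarrow> nat \<Rightarrow> real \<Rightarrow> real \<Rightarrow> (nat \<Rightarrow> real) \<Rightarrow> (nat \<Rightarrow> real) \<Rightarrow> (nat \<Rightarrow> real) \<Rightarrow> (nat \<Rightarrow> real) \<Rightarrow>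
   real \<Rightarrow> real \<Rightarrow> (nat \<Rightarrow> real) \<Rightarrow> (nat \<Rightarrow> real) \<Rightarrow> (nat \<Rightarrow> real \<Rightarrow> real) \<Rightarrow> bool" where
  "forced_solution_on T n c d h \<omega> lam f \<Omega> \<epsilon> y0 v0 y \<longleftrightarrow> (\<exists>v w. \<forall>k\<in>{1..n}.
     y k 0 = y0 k \<and> v k 0 = v0 k \<and>
     (\<forall>t\<in>{0..T}.
        (y k has_real_derivative v k t) (at t within {0..T}) \<and>
        (v k has_real_derivative w k t) (at t within {0..T}) \<and>
        w k t + \<epsilon> * lam k * v k t + (\<omega> k)^2 * y k t +
          h k * (c * (\<Sum>i=1..n. y i t * h i)^2 + d / \<epsilon> * (\<Sum>i=1..n. y i t * h i)^3)
        = \<epsilon>^2 * f k * cos (\<Omega> * t)))"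

text \<open>Families, indexed by \<open>\<epsilon>\<close>, of initial positions and velocities that are those of the
  stationary solution \<open>(a, \<beta>)\<close> up to \<open>O(\<epsilon>\<^sup>2)\<close>.\<close>

definition stationary_initial_data ::
  "nat \<Rightarrow> real \<Rightarrow> real \<Rightarrow> real \<Rightarrow> (real \<Rightarrow> nat \<Rightarrow> real) \<Rightarrow> (real \<Rightarrow> nat \<Rightarrow> real) \<Rightarrow> bool" where
  "stationary_initial_data n w a \<beta> y0 v0 \<longleftrightarrow>
     (\<lambda>\<epsilon>. y0 \<epsilon> 1 - \<epsilon> * a * cos \<beta>) \<in> O[at_right 0](\<lambda>\<epsilon>. \<epsilon>^2) \<and>
     (\<lambda>\<epsilon>. v0 \<epsilon> 1 - (- \<epsilon> * w * a * sin \<beta>)) \<in> O[at_right 0](\<lambda>\<epsilon>. \<epsilon>^2) \<and>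
     (\<forall>k\<in>{2..n}. (\<lambda>\<epsilon>. y0 \<epsilon> k) \<in> O[at_right 0](\<lambda>\<epsilon>. \<epsilon>^2) \<and> (\<forall>\<epsilon>>0. v0 \<epsilon> k = 0))"

definition uniformly_bounded_C2 :: "real \<Rightarrow> (real \<Rightarrow> real \<Rightarrow> real) \<Rightarrow> bool" where
  "uniformly_bounded_C2 \<gamma> r \<longleftrightarrow> (\<exists>C. \<forall>\<^sub>F \<epsilon> in at_right 0. \<exists>r' r''.
     continuous_on {0<..<\<gamma>/\<epsilon>} r'' \<and>
     (\<forall>t\<in>{0<..<\<gamma>/\<epsilon>}.
        (r \<epsilon> has_real_derivative r' t) (at t) \<and> (r' has_real_derivative r'' t) (at t) \<and>
        \<bar>r \<epsilon> t\<bar> \<le> C \<and> \<bar>r' t\<bar> \<le> C \<and> \<bar>r'' t\<bar> \<le> C))"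

end

theory Submission
  imports Defs "HOL-Analysis.Uniform_Limit" "HOL-Analysis.Henstock_Kurzweil_Integration"
begin

text \<open>A maximal amplitude is \<open>f\<^sub>1 / (\<lambda>\<^sub>1 \<omega>\<^sub>1)\<close>, forced by \<open>sin \<beta> \<ge> - 1\<close>.

  For the approximation, write \<open>y\<^sub>k = \<epsilon> a \<delta>\<^bsub>k1\<^esub> sin (\<Omega> t) + \<epsilon>\<^sup>2 (P\<^sub>k (\<Omega> t) + \<rho>\<^sub>k)\<close>, where the
  trigonometric polynomial \<open>P\<^sub>k\<close> absorbs all terms of order \<open>\<epsilon>\<^sup>2\<close>. It exists because \<open>\<omega>\<^sub>k\<close> is not in
  resonance with the harmonics \<open>0, \<omega>\<^sub>1, 2 \<omega>\<^sub>1, 3 \<omega>\<^sub>1\<close> for \<open>k \<noteq> 1\<close>, and because amplitude and detuning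
  of the maximal solution remove the resonant terms for \<open>k = 1\<close>. What remains is
  \<open>\<rho>\<^sub>k'' + \<omega>\<^sub>k\<^sup>2 \<rho>\<^sub>k = \<epsilon> G\<^sub>k\<close> with \<open>G\<^sub>k\<close> bounded and Lipschitz on bounded sets uniformly in \<open>\<epsilon>\<close> and \<open>t\<close>.
  In rotating coordinates the velocity is \<open>O(\<epsilon>)\<close>, so that on \<open>[0, \<gamma>/\<epsilon>]\<close> with \<open>\<gamma>\<close> small the
  Picard iteration contracts and stays in a fixed ball: existence and the uniform bound come together.\<close>

section \<open>Picard iteration that stays in a ball\<close>

text \<open>A field of size at most \<open>B\<close> moves a point by at most \<open>T * B\<close>
  in time \<open>T\<close>, so the Picard map preserves the ball of radius \<open>R\<close>. It
  contracts by the factor \<open>T * L\<close> in the supremum over time and coordinates, which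
  \<open>\<delta>\<close> expresses as a common bound. The solution is a limit of iterates in the
  ball, so its bound needs no separate continuation argument.\<close>

lemma picard_box:
  fixes g :: "real \<Rightarrow> (nat \<Rightarrow> 'a::euclidean_space) \<Rightarrow> nat \<Rightarrow> 'a"
  assumes T: "T \<ge> 0" and L: "L \<ge> 0" "T * L < 1"
    and z0: "\<And>j. norm (z0 j) + T * B \<le> R"
    and bound: "\<And>t z j. t \<in> {0..T} \<Longrightarrow> (\<And>i. norm (z i) \<le> R) \<Longrightarrow> norm (g t z j) \<le> B"
    and lip: "\<And>t z z' j \<delta>. t \<in> {0..T} \<Longrightarrow> (\<And>i. norm (z i) \<le> R) \<Longrightarrow> (\<And>i. norm (z' i) \<le> R) \<Longrightarrow>
      (\<And>i. norm (z i - z' i) \<le> \<delta>) \<Longrightarrow> norm (g t z j - g t z' j) \<le> L * \<delta>"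
    and cont: "\<And>u j. (\<And>i. continuous_on {0..T} (u i)) \<Longrightarrow> continuous_on {0..T} (\<lambda>t. g t (\<lambda>i. u i t) j)"
    and B: "B \<ge> 0"
  obtains u where "\<And>j. u j 0 = z0 j" "\<And>j t. t \<in> {0..T} \<Longrightarrow> norm (u j t) \<le> R"
    "\<And>j t. t \<in> {0..T} \<Longrightarrow> (u j has_vector_derivative g t (\<lambda>i. u i t) j) (at t within {0..T})"
proof -
  define q where "q = T * L"
  have q: "0 \<le> q" "q < 1" using T L by (auto simp: q_def)
  define F where "F u = (\<lambda>j t. z0 j + integral {0..t} (\<lambda>s. g s (\<lambda>i. u i s) j))"
    for u :: "nat \<Rightarrow> real \<Rightarrow> 'a"
  define S where "S = {u :: nat \<Rightarrow> real \<Rightarrow> 'a. \<forall>j. continuous_on {0..T} (u j) \<and> (\<forall>t\<in>{0..T}. norm (u j t) \<le> R)}"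
  have gcont: "continuous_on {0..T} (\<lambda>s. g s (\<lambda>i. u i s) j)" if "u \<in> S" for u j
    using that by (intro cont) (auto simp: S_def)
  have gint: "(\<lambda>s. g s (\<lambda>i. u i s) j) integrable_on {0..t}" if "u \<in> S" "t \<in> {0..T}" for u j t
    using that by (intro integrable_continuous_real continuous_on_subset[OF gcont]) auto
  have FS: "F u \<in> S" if u: "u \<in> S" for u
  proof -
    have "continuous_on {0..T} (F u j)" for j
      unfolding F_def using gint[OF u] T
      by (intro continuous_intros indefinite_integral_continuous_1) auto
    moreover have "norm (F u j t) \<le> R" if t: "t \<in> {0..T}" for j t
    proof -
      have "norm (integral {0..t} (\<lambda>s. g s (\<lambda>i. u i s) j)) \<le> integral {0..t} (\<lambda>s. B)"
        using t u by (intro integral_norm_bound_integral gint bound) (auto simp: S_def)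
      also have "\<dots> \<le> T * B" using t B by (auto intro: mult_right_mono)
      finally show ?thesis
        unfolding F_def using z0[of j] norm_triangle_ineq[of "z0 j"] by (meson add_left_mono order_trans)
    qed
    ultimately show ?thesis by (auto simp: S_def)
  qed
  have lipF: "norm (F u j t - F v j t) \<le> q * \<delta>"
    if u: "u \<in> S" and v: "v \<in> S" and t: "t \<in> {0..T}"
      and d: "\<And>i s. s \<in> {0..T} \<Longrightarrow> norm (u i s - v i s) \<le> \<delta>" for u v j t \<delta>
  proof -
    \<comment> \<open>\<open>\<delta>\<close> is nonnegative because it bounds a norm; this permits
      the later enlargement of \<open>t\<close> to \<open>T\<close>.\<close>
    have "0 \<le> norm (u 0 0 - v 0 0)" by simp
    also have "\<dots> \<le> \<delta>" using T by (intro d) auto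
    finally have d0: "0 \<le> \<delta>" .
    have "F u j t - F v j t = integral {0..t} (\<lambda>s. g s (\<lambda>i. u i s) j - g s (\<lambda>i. v i s) j)"
      unfolding F_def using gint[OF u t] gint[OF v t] by (simp add: integral_diff)
    also have "norm \<dots> \<le> integral {0..t} (\<lambda>s. L * \<delta>)"
      using u v t d by (intro integral_norm_bound_integral integrable_diff gint lip) (auto simp: S_def)
    also have "\<dots> = t * (L * \<delta>)" using t by simp
    also have "\<dots> \<le> T * (L * \<delta>)" using t L d0 by (intro mult_right_mono) auto
    finally show ?thesis by (simp add: q_def mult.assoc)
  qed
  define U where "U m = (F ^^ m) (\<lambda>j t. z0 j)" for m
  have U0: "U 0 = (\<lambda>j t. z0 j)" and USuc: "U (Suc m) = F (U m)" for m by (auto simp: U_def)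
  have US: "U m \<in> S" for m
  proof (induction m)
    case 0
    have "norm (z0 j) \<le> R" for j using z0[of j] mult_nonneg_nonneg[OF T B] by linarith
    then show ?case by (auto simp: U0 S_def)
  qed (auto simp: USuc FS)
  \<comment> \<open>The first two iterates lie in the ball, hence differ by at most
    \<open>2 * R\<close>; each further step gains a factor \<open>q\<close>.\<close>
  have step: "norm (U (Suc m) j t - U m j t) \<le> 2 * R * q ^ m" if "t \<in> {0..T}" for m j t
    using that
  proof (induction m arbitrary: j t)
    case 0
    have "norm (U 1 j t) \<le> R" "norm (U 0 j t) \<le> R" using US 0 by (auto simp: S_def)
    then show ?case using norm_triangle_ineq4[of "U 1 j t" "U 0 j t"] by simp
  next
    case (Suc m)
    have "norm (F (U (Suc m)) j t - F (U m) j t) \<le> q * (2 * R * q ^ m)"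
      using Suc by (intro lipF US) auto
    then show ?case by (simp add: USuc mult_ac)
  qed
  have sm: "summable (\<lambda>m. 2 * R * q ^ m)" using q by (intro summable_mult summable_geometric) auto
  \<comment> \<open>The limit is written as a telescoping series, to which the Weierstrass test
    applies.\<close>
  define u where "u j t = z0 j + (\<Sum>m. U (Suc m) j t - U m j t)" for j t
  have ul: "uniform_limit {0..T} (\<lambda>m. U m j) (u j) sequentially" for j
  proof -
    have "uniform_limit {0..T} (\<lambda>m t. \<Sum>i<m. U (Suc i) j t - U i j t) (\<lambda>t. \<Sum>i. U (Suc i) j t - U i j t) sequentially"
      by (rule Weierstrass_m_test[OF step sm])
    then have "uniform_limit {0..T} (\<lambda>m t. z0 j + (\<Sum>i<m. U (Suc i) j t - U i j t)) (u j) sequentially"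
      unfolding u_def[abs_def] by (intro uniform_limit_intros)
    moreover have "(\<Sum>i<m. U (Suc i) j t - U i j t) = U m j t - z0 j" for m t
      using sum_lessThan_telescope[of "\<lambda>i. U i j t" m] by (simp add: U0)
    ultimately show ?thesis by simp
  qed
  have lim: "(\<lambda>m. U m j t) \<longlonglongrightarrow> u j t" if "t \<in> {0..T}" for j t
    by (rule tendsto_uniform_limitI[OF ul that])
  have uS: "u \<in> S"
  proof -
    have "continuous_on {0..T} (u j)" for j
      using US by (intro uniform_limit_theorem[OF _ ul]) (auto simp: S_def)
    moreover have "norm (u j t) \<le> R" if "t \<in> {0..T}" for j t
      using US that by (intro tendsto_upperbound[OF tendsto_norm[OF lim[OF that]]]) (auto simp: S_def)
    ultimately show ?thesis by (auto simp: S_def)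
  qed
  \<comment> \<open>The distance from iterate \<open>m\<close> to iterate \<open>k + m\<close> is
    bounded by a geometric sum independent of \<open>k\<close>, and then \<open>k\<close> tends to
    infinity.\<close>
  have rate: "norm (u j t - U m j t) \<le> 2 * R / (1 - q) * q ^ m" if t: "t \<in> {0..T}" for m j t
  proof (rule tendsto_upperbound)
    show "(\<lambda>k. norm (U (k + m) j t - U m j t)) \<longlonglongrightarrow> norm (u j t - U m j t)"
      by (intro tendsto_intros LIMSEQ_ignore_initial_segment lim t)
    have R: "0 \<le> R" using z0[of 0] mult_nonneg_nonneg[OF T B] norm_ge_zero[of "z0 0"] by linarith
    have "norm (U (k + m) j t - U m j t) \<le> 2 * R / (1 - q) * q ^ m" for k
    proof -
      have "norm (U (k + m) j t - U m j t) \<le> (\<Sum>i<k. 2 * R * q ^ m * q ^ i)"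
      proof (induction k)
        case (Suc k)
        have "norm (U (Suc k + m) j t - U m j t) \<le> norm (U (Suc k + m) j t - U (k + m) j t) + norm (U (k + m) j t - U m j t)"
          by norm
        then show ?case using Suc step[OF t, of "k + m" j] by (simp add: power_add mult_ac)
      qed simp
      also have "\<dots> = 2 * R * q ^ m * ((1 - q ^ k) / (1 - q))"
        unfolding sum_distrib_left[symmetric] using q sum_gp_strict[of q k] by auto
      also have "\<dots> \<le> 2 * R * q ^ m * (1 / (1 - q))"
        using q R by (intro mult_left_mono divide_right_mono) auto
      finally show ?thesis by (simp add: mult_ac)
    qed
    then show "\<forall>\<^sub>F k in sequentially. norm (U (k + m) j t - U m j t) \<le> 2 * R / (1 - q) * q ^ m" by simp
  qed simp
  \<comment> \<open>The shifted iterates tend to \<open>u\<close>. Being images under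
    \<open>F\<close>, they also tend to \<open>F u\<close>, by \<open>lipF\<close> and
    \<open>rate\<close>.\<close>
  have fixpt: "u j t = F u j t" if t: "t \<in> {0..T}" for j t
  proof (rule LIMSEQ_unique)
    show "(\<lambda>m. U (Suc m) j t) \<longlonglongrightarrow> u j t" using lim[OF t] by (rule LIMSEQ_Suc)
    have "(\<lambda>m. U (Suc m) j t - F u j t) \<longlonglongrightarrow> 0"
    proof (rule Lim_null_comparison)
      have "norm (U (Suc m) j t - F u j t) \<le> q * (2 * R / (1 - q) * q ^ m)" for m
        unfolding USuc using rate by (intro lipF US uS t) (auto simp: norm_minus_commute)
      then show "\<forall>\<^sub>F m in sequentially. norm (U (Suc m) j t - F u j t) \<le> q * (2 * R / (1 - q) * q ^ m)" by simp
      show "(\<lambda>m. q * (2 * R / (1 - q) * q ^ m)) \<longlonglongrightarrow> 0"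
        using q by (intro tendsto_mult_right_zero LIMSEQ_power_zero) auto
    qed
    then show "(\<lambda>m. U (Suc m) j t) \<longlonglongrightarrow> F u j t" by (simp add: LIM_zero_iff)
  qed
  show ?thesis
  proof (rule that)
    show "u j 0 = z0 j" for j using fixpt[of 0 j] T by (simp add: F_def)
    show "norm (u j t) \<le> R" if "t \<in> {0..T}" for t j using uS that by (simp add: S_def)
    fix j t assume t: "t \<in> {0..T}"
    have "((\<lambda>t. integral {0..t} (\<lambda>s. g s (\<lambda>i. u i s) j)) has_vector_derivative g t (\<lambda>i. u i t) j) (at t within {0..T})"
      by (rule integral_has_vector_derivative[OF gcont[OF uS] t])
    then have "(F u j has_vector_derivative g t (\<lambda>i. u i t) j) (at t within {0..T})"
      unfolding F_def by (auto intro!: derivative_eq_intros)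
    then show "(u j has_vector_derivative g t (\<lambda>i. u i t) j) (at t within {0..T})"
      by (rule has_vector_derivative_transform[OF t, rotated]) (use fixpt in auto)
  qed
qed

section \<open>Coupled oscillators under a weak perturbation\<close>

text \<open>Only the perturbation \<open>G\<close> enters the conditions on \<open>T\<close>,
  because the free rotation preserves the norm of \<open>(x, v / \<omega>)\<close>. If
  \<open>G\<close> is of order \<epsilon>, so are \<open>B\<close> and \<open>L\<close>, and
  \<open>T\<close> may be of order 1/\<epsilon>. The weights \<open>\<omega>\<close> on velocities
  and on \<open>G\<close> are those of this norm.\<close>

lemma oscillators_solution_exists:
  fixes G :: "nat \<Rightarrow> real \<Rightarrow> (nat \<Rightarrow> real) \<Rightarrow> (nat \<Rightarrow> real) \<Rightarrow> real"
    and \<omega> x0 v0 :: "nat \<Rightarrow> real"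
  assumes T: "T \<ge> 0" and L: "L \<ge> 0" "T * L < 1" and B: "B \<ge> 0" "T * B \<le> R"
    and \<omega>: "\<And>k. k \<in> K \<Longrightarrow> \<omega> k > 0"
    and init: "\<And>k. k \<in> K \<Longrightarrow> \<bar>x0 k\<bar> + \<bar>v0 k\<bar> / \<omega> k + T * B \<le> R"
    and bound: "\<And>t x v k. t \<in> {0..T} \<Longrightarrow> k \<in> K \<Longrightarrow> (\<And>i. i \<in> K \<Longrightarrow> \<bar>x i\<bar> \<le> R) \<Longrightarrow>
      (\<And>i. i \<in> K \<Longrightarrow> \<bar>v i\<bar> \<le> \<omega> i * R) \<Longrightarrow> \<bar>G k t x v\<bar> \<le> \<omega> k * B"
    and lip: "\<And>t x v x' v' k \<delta>. t \<in> {0..T} \<Longrightarrow> k \<in> K \<Longrightarrow>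
      (\<And>i. i \<in> K \<Longrightarrow> \<bar>x i\<bar> \<le> R) \<Longrightarrow> (\<And>i. i \<in> K \<Longrightarrow> \<bar>v i\<bar> \<le> \<omega> i * R) \<Longrightarrow>
      (\<And>i. i \<in> K \<Longrightarrow> \<bar>x' i\<bar> \<le> R) \<Longrightarrow> (\<And>i. i \<in> K \<Longrightarrow> \<bar>v' i\<bar> \<le> \<omega> i * R) \<Longrightarrow>
      (\<And>i. i \<in> K \<Longrightarrow> \<bar>x i - x' i\<bar> \<le> \<delta>) \<Longrightarrow> (\<And>i. i \<in> K \<Longrightarrow> \<bar>v i - v' i\<bar> \<le> \<omega> i * \<delta>) \<Longrightarrow>
      \<bar>G k t x v - G k t x' v'\<bar> \<le> \<omega> k * (L * \<delta>)"
    and cont: "\<And>x v k. k \<in> K \<Longrightarrow> (\<And>i. i \<in> K \<Longrightarrow> continuous_on {0..T} (x i)) \<Longrightarrow>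
      (\<And>i. i \<in> K \<Longrightarrow> continuous_on {0..T} (v i)) \<Longrightarrow>
      continuous_on {0..T} (\<lambda>t. G k t (\<lambda>i. x i t) (\<lambda>i. v i t))"
  obtains x v where
    "\<And>k. k \<in> K \<Longrightarrow> x k 0 = x0 k" "\<And>k. k \<in> K \<Longrightarrow> v k 0 = v0 k"
    "\<And>k t. k \<in> K \<Longrightarrow> t \<in> {0..T} \<Longrightarrow> \<bar>x k t\<bar> \<le> R"
    "\<And>k t. k \<in> K \<Longrightarrow> t \<in> {0..T} \<Longrightarrow> \<bar>v k t\<bar> \<le> \<omega> k * R"
    "\<And>k t. k \<in> K \<Longrightarrow> t \<in> {0..T} \<Longrightarrow> (x k has_real_derivative v k t) (at t within {0..T})"
    "\<And>k t. k \<in> K \<Longrightarrow> t \<in> {0..T} \<Longrightarrow> (v k has_real_derivative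
       - (\<omega> k)\<^sup>2 * x k t + G k t (\<lambda>i. x i t) (\<lambda>i. v i t)) (at t within {0..T})"
proof -
  \<comment> \<open>Rotating coordinates: \<open>x - \<i> v / \<omega> = z e\<^bsup>\<i> \<omega> t\<^esup>\<close>, so that \<open>z' = - \<i> (G / \<omega>) e\<^bsup>- \<i> \<omega> t\<^esup>\<close>.\<close>
  define X where "X t z i = Re (z i * cis (\<omega> i * t))" for t :: real and z :: "nat \<Rightarrow> complex" and i
  define V where "V t z i = - (\<omega> i * Im (z i * cis (\<omega> i * t)))" for t :: real and z :: "nat \<Rightarrow> complex" and i
  define g where "g t z k = (if k \<in> K then - \<i> * of_real (G k t (X t z) (V t z) / \<omega> k) * cis (- (\<omega> k * t)) else 0)"
    for t z k
  have abs_XV: "\<bar>X t z i\<bar> \<le> norm (z i)" "i \<in> K \<Longrightarrow> \<bar>V t z i\<bar> \<le> \<omega> i * norm (z i)" for t z i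
  proof -
    show "\<bar>X t z i\<bar> \<le> norm (z i)"
      using abs_Re_le_cmod[of "z i * cis (\<omega> i * t)"] by (simp add: X_def norm_mult del: times_complex.sel)
    show "\<bar>V t z i\<bar> \<le> \<omega> i * norm (z i)" if "i \<in> K"
      using abs_Im_le_cmod[of "z i * cis (\<omega> i * t)"] \<omega>[OF that]
      by (simp add: V_def norm_mult abs_mult del: times_complex.sel)
  qed
  \<comment> \<open>Position and velocity are linear in \<open>z\<close>, so the size estimates also
    serve as Lipschitz estimates.\<close>
  have diff_XV: "X t z i - X t z' i = X t (\<lambda>i. z i - z' i) i" "V t z i - V t z' i = V t (\<lambda>i. z i - z' i) i" for t z z' i
    by (simp_all add: X_def V_def algebra_simps)
  have XV_le: "\<bar>X t z i\<bar> \<le> r" "i \<in> K \<Longrightarrow> \<bar>V t z i\<bar> \<le> \<omega> i * r" if "norm (z i) \<le> r" for t z i r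
    using abs_XV[where t = t and z = z and i = i] that \<omega>[of i] by (auto intro: order_trans mult_left_mono)
  \<comment> \<open>Coordinates outside \<open>K\<close> start at zero and stand still, so that all
    natural numbers can serve as indices.\<close>
  define z0 where "z0 k = (if k \<in> K then Complex (x0 k) (- v0 k / \<omega> k) else 0)" for k
  obtain u where u: "\<And>j. u j 0 = z0 j" "\<And>j t. t \<in> {0..T} \<Longrightarrow> norm (u j t) \<le> R"
    "\<And>j t. t \<in> {0..T} \<Longrightarrow> (u j has_vector_derivative g t (\<lambda>i. u i t) j) (at t within {0..T})"
  proof (rule picard_box[of T L z0 B R g])
    show "norm (z0 j) + T * B \<le> R" for j
      using init[of j] cmod_le[of "z0 j"] \<omega>[of j] B by (auto simp: z0_def)
    show "norm (g t z j) \<le> B" if "t \<in> {0..T}" "\<And>i. norm (z i) \<le> R" for t z j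
    proof (cases "j \<in> K")
      case True
      have "\<bar>G j t (X t z) (V t z)\<bar> \<le> \<omega> j * B" using that True by (intro bound XV_le)
      then show ?thesis using True \<omega>[OF True] by (simp add: g_def norm_mult norm_divide field_simps)
    qed (use B in \<open>simp add: g_def\<close>)
    show "norm (g t z j - g t z' j) \<le> L * \<delta>" if "t \<in> {0..T}" "\<And>i. norm (z i) \<le> R" "\<And>i. norm (z' i) \<le> R"
      "\<And>i. norm (z i - z' i) \<le> \<delta>" for t z z' j \<delta>
    proof (cases "j \<in> K")
      case True
      have "\<bar>G j t (X t z) (V t z) - G j t (X t z') (V t z')\<bar> \<le> \<omega> j * (L * \<delta>)"
        using that True by (intro lip XV_le) (simp_all add: diff_XV XV_le)
      moreover have eq: "g t z j - g t z' j =
        - \<i> * of_real ((G j t (X t z) (V t z) - G j t (X t z') (V t z')) / \<omega> j) * cis (- (\<omega> j * t))"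
        using True by (simp add: g_def diff_divide_distrib algebra_simps)
      have "norm (g t z j - g t z' j) = \<bar>G j t (X t z) (V t z) - G j t (X t z') (V t z')\<bar> / \<omega> j"
        unfolding eq using \<omega>[OF True]
        by (simp add: norm_mult abs_divide del: of_real_diff of_real_divide)
      ultimately show ?thesis using \<omega>[OF True] by (simp add: pos_divide_le_eq mult_ac)
    next
      case False
      then show ?thesis using L order_trans[OF norm_ge_zero that(4)[of 0]] by (simp add: g_def)
    qed
    show "continuous_on {0..T} (\<lambda>t. g t (\<lambda>i. u i t) j)" if "\<And>i. continuous_on {0..T} (u i)" for u j
    proof (cases "j \<in> K")
      case True
      have cis: "continuous_on {0..T} (\<lambda>t. cis (w * t))" for w
        by (auto simp: cis_conv_exp intro!: continuous_intros)
      have "continuous_on {0..T} (\<lambda>t. G j t (\<lambda>i. X t (\<lambda>i. u i t) i) (\<lambda>i. V t (\<lambda>i. u i t) i))"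
        unfolding X_def V_def using that True by (intro cont continuous_intros cis)
      then show ?thesis
        using True \<omega>[OF True] cis[of "- \<omega> j"] by (auto simp: g_def intro!: continuous_intros)
    qed (simp add: g_def)
  qed (use T L B in auto)
  define x where "x k t = X t (\<lambda>i. u i t) k" for k t
  define v where "v k t = V t (\<lambda>i. u i t) k" for k t
  show ?thesis
  proof (rule that[of x v])
    fix k assume k: "k \<in> K"
    show "x k 0 = x0 k" "v k 0 = v0 k"
      using u(1)[of k] k \<omega>[OF k] by (auto simp: x_def v_def X_def V_def z0_def)
    fix t assume t: "t \<in> {0..T}"
    show "\<bar>x k t\<bar> \<le> R" "\<bar>v k t\<bar> \<le> \<omega> k * R" using XV_le u(2)[OF t] k by (auto simp: x_def v_def)
    define e where "e = G k t (\<lambda>i. x i t) (\<lambda>i. v i t) / \<omega> k"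
    have d: "(u k has_vector_derivative - \<i> * of_real e * cis (- (\<omega> k * t))) (at t within {0..T})"
      using u(3)[OF t, of k] k by (simp add: g_def e_def x_def v_def)
    have re: "((\<lambda>t. Re (u k t)) has_real_derivative - (e * sin (\<omega> k * t))) (at t within {0..T})"
      using bounded_linear.has_vector_derivative[OF bounded_linear_Re d]
      by (simp add: has_real_derivative_iff_has_vector_derivative)
    have im: "((\<lambda>t. Im (u k t)) has_real_derivative - (e * cos (\<omega> k * t))) (at t within {0..T})"
      using bounded_linear.has_vector_derivative[OF bounded_linear_Im d]
      by (simp add: has_real_derivative_iff_has_vector_derivative)
    have x_eq: "x k = (\<lambda>t. Re (u k t) * cos (\<omega> k * t) - Im (u k t) * sin (\<omega> k * t))"
      and v_eq: "v k = (\<lambda>t. - (\<omega> k * (Re (u k t) * sin (\<omega> k * t) + Im (u k t) * cos (\<omega> k * t))))"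
      by (auto simp: x_def X_def v_def V_def)
    show "(x k has_real_derivative v k t) (at t within {0..T})"
      unfolding x_eq v_eq by (rule re im derivative_eq_intros refl)+ (simp add: algebra_simps)
    \<comment> \<open>With the sum of squares left unevaluated, the comparison of derivatives is a
      polynomial identity in the sine and cosine.\<close>
    have "(v k has_real_derivative - (\<omega> k)\<^sup>2 * x k t + \<omega> k * e * ((sin (\<omega> k * t))\<^sup>2 + (cos (\<omega> k * t))\<^sup>2)) (at t within {0..T})"
      unfolding x_eq v_eq by (rule re im derivative_eq_intros refl)+ (simp add: algebra_simps power2_eq_square del: sin_cos_squared_add sin_cos_squared_add2 sin_cos_squared_add3)
    then show "(v k has_real_derivative - (\<omega> k)\<^sup>2 * x k t + G k t (\<lambda>i. x i t) (\<lambda>i. v i t)) (at t within {0..T})"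
      using \<omega>[OF k] by (simp add: e_def sin_cos_squared_add)
  qed
qed

section \<open>Second-order correctors and a cubic estimate\<close>

text \<open>Since sin^2 \<theta> = (1 - cos 2\<theta>)/2 and sin^3 \<theta> = (3 sin \<theta> - sin
  3\<theta>)/4, the right-hand side contains only the harmonics 0 to 3. Harmonic j is solved by
  dividing its coefficient by \<nu>^2 - j^2 w^2. If \<nu>^2 = w^2, the last assumption makes both
  coefficients of the first harmonic vanish.\<close>

lemma nonresonant_corrector:
  fixes \<nu> w F E \<alpha> \<beta> :: real
  assumes "\<nu> \<noteq> 0" "\<nu>\<^sup>2 \<noteq> 4 * w\<^sup>2" "\<nu>\<^sup>2 \<noteq> 9 * w\<^sup>2" "\<nu>\<^sup>2 = w\<^sup>2 \<Longrightarrow> F = 0 \<and> E = 3 * \<beta> / 4"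
  shows "\<exists>P P' P'' C. (\<forall>\<theta>. (P has_real_derivative P' \<theta>) (at \<theta>)) \<and> (\<forall>\<theta>. (P' has_real_derivative P'' \<theta>) (at \<theta>)) \<and>
    continuous_on UNIV P'' \<and> (\<forall>\<theta>. \<bar>P \<theta>\<bar> \<le> C \<and> \<bar>P' \<theta>\<bar> \<le> C \<and> \<bar>P'' \<theta>\<bar> \<le> C) \<and>
    (\<forall>\<theta>. w\<^sup>2 * P'' \<theta> + \<nu>\<^sup>2 * P \<theta> = F * cos \<theta> + E * sin \<theta> - (\<alpha> * sin \<theta> ^ 2 + \<beta> * sin \<theta> ^ 3))"
proof -
  \<comment> \<open>In the resonant case the quotients \<open>c1\<close> and \<open>s1\<close> are \<open>0 / 0 = 0\<close>.\<close>
  define c0 where "c0 = - \<alpha> / (2 * \<nu>\<^sup>2)"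
  define c1 where "c1 = F / (\<nu>\<^sup>2 - w\<^sup>2)"
  define s1 where "s1 = (E - 3 * \<beta> / 4) / (\<nu>\<^sup>2 - w\<^sup>2)"
  define c2 where "c2 = \<alpha> / 2 / (\<nu>\<^sup>2 - 4 * w\<^sup>2)"
  define s3 where "s3 = \<beta> / 4 / (\<nu>\<^sup>2 - 9 * w\<^sup>2)"
  have coeff: "\<nu>\<^sup>2 * c0 = - \<alpha> / 2" "(\<nu>\<^sup>2 - w\<^sup>2) * c1 = F" "(\<nu>\<^sup>2 - w\<^sup>2) * s1 = E - 3 * \<beta> / 4"
    "(\<nu>\<^sup>2 - 4 * w\<^sup>2) * c2 = \<alpha> / 2" "(\<nu>\<^sup>2 - 9 * w\<^sup>2) * s3 = \<beta> / 4"
  proof -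
    have cancel: "x * (y / x) = y" if "x \<noteq> 0" for x y :: real using that by simp
    show "(\<nu>\<^sup>2 - 4 * w\<^sup>2) * c2 = \<alpha> / 2" "(\<nu>\<^sup>2 - 9 * w\<^sup>2) * s3 = \<beta> / 4"
      unfolding c2_def s3_def by (rule cancel, use assms(2,3) in simp)+
  qed (use assms(1,4) in \<open>auto simp: c0_def c1_def s1_def\<close>)
  define P where "P \<theta> = c0 + c1 * cos \<theta> + s1 * sin \<theta> + c2 * cos (2 * \<theta>) + s3 * sin (3 * \<theta>)" for \<theta>
  define P' where "P' \<theta> = - c1 * sin \<theta> + s1 * cos \<theta> - 2 * c2 * sin (2 * \<theta>) + 3 * s3 * cos (3 * \<theta>)" for \<theta>
  define P'' where "P'' \<theta> = - c1 * cos \<theta> - s1 * sin \<theta> - 4 * c2 * cos (2 * \<theta>) - 9 * s3 * sin (3 * \<theta>)" for \<theta>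
  \<comment> \<open>The factors 4 and 9 come from two differentiations of the harmonics 2 and 3;
    they also cover \<open>P\<close> and \<open>P'\<close>.\<close>
  define C where "C = \<bar>c0\<bar> + \<bar>c1\<bar> + \<bar>s1\<bar> + 4 * \<bar>c2\<bar> + 9 * \<bar>s3\<bar>"
  have trig: "x * cos t \<le> \<bar>x\<bar> \<and> - (x * cos t) \<le> \<bar>x\<bar> \<and> x * sin t \<le> \<bar>x\<bar> \<and> - (x * sin t) \<le> \<bar>x\<bar>" for x t :: real
    using mult_left_mono[OF abs_cos_le_one[of t] abs_ge_zero[of x]] mult_left_mono[OF abs_sin_le_one[of t] abs_ge_zero[of x]]
    by (auto simp: abs_mult[symmetric])
  have bounds: "\<bar>P \<theta>\<bar> \<le> C" "\<bar>P' \<theta>\<bar> \<le> C" "\<bar>P'' \<theta>\<bar> \<le> C" for \<theta>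
    unfolding P_def P'_def P''_def C_def
    using trig[of c1 \<theta>] trig[of s1 \<theta>] trig[of c2 "2 * \<theta>"] trig[of s3 "3 * \<theta>"]
      abs_ge_self[of c0] abs_ge_minus_self[of c0] abs_ge_zero[of c0] abs_ge_zero[of c2] abs_ge_zero[of s3]
    by - (rule abs_leI; argo)+
  have cos2: "cos (2 * \<theta>) = 1 - 2 * sin \<theta> ^ 2" for \<theta> :: real
    by (rule cos_double_sin)
  have sin3: "sin (3 * \<theta>) = 3 * sin \<theta> - 4 * sin \<theta> ^ 3" for \<theta> :: real
  proof -
    have "sin (3 * \<theta>) = sin (2 * \<theta>) * cos \<theta> + cos (2 * \<theta>) * sin \<theta>"
      using sin_add[of "2 * \<theta>" \<theta>] by simp
    also have "\<dots> = 2 * sin \<theta> * (cos \<theta>)\<^sup>2 + (1 - 2 * sin \<theta> ^ 2) * sin \<theta>"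
      by (simp add: sin_double cos2 power2_eq_square)
    also have "\<dots> = 3 * sin \<theta> - 4 * sin \<theta> ^ 3"
      unfolding cos_squared_eq by (simp add: algebra_simps power2_eq_square power3_eq_cube)
    finally show ?thesis .
  qed
  have eq: "w\<^sup>2 * P'' \<theta> + \<nu>\<^sup>2 * P \<theta> = F * cos \<theta> + E * sin \<theta> - (\<alpha> * sin \<theta> ^ 2 + \<beta> * sin \<theta> ^ 3)" for \<theta>
  proof -
    have "w\<^sup>2 * P'' \<theta> + \<nu>\<^sup>2 * P \<theta> = \<nu>\<^sup>2 * c0 + ((\<nu>\<^sup>2 - w\<^sup>2) * c1) * cos \<theta> + ((\<nu>\<^sup>2 - w\<^sup>2) * s1) * sin \<theta>
      + ((\<nu>\<^sup>2 - 4 * w\<^sup>2) * c2) * cos (2 * \<theta>) + ((\<nu>\<^sup>2 - 9 * w\<^sup>2) * s3) * sin (3 * \<theta>)"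
      by (simp add: P_def P''_def algebra_simps)
    also have "\<dots> = F * cos \<theta> + E * sin \<theta> - (\<alpha> * sin \<theta> ^ 2 + \<beta> * sin \<theta> ^ 3)"
      unfolding coeff sin3 cos2 by (simp add: field_simps)
    finally show ?thesis .
  qed
  have "(P has_real_derivative P' \<theta>) (at \<theta>)" "(P' has_real_derivative P'' \<theta>) (at \<theta>)" for \<theta>
    unfolding P_def[abs_def] P'_def[abs_def] P''_def by (auto intro!: derivative_eq_intros)
  moreover have "continuous_on UNIV P''" unfolding P''_def[abs_def] by (intro continuous_intros)
  ultimately show ?thesis using bounds eq by blast
qed

text \<open>The difference factors as (x - y) times A + B (x + y) + C (x^2 + x y + y^2), and the
  second factor is bounded for arguments of size at most \<open>H\<close>.\<close>

lemma cubic_lipschitz: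
  fixes A B C x y :: real
  assumes "\<bar>A\<bar> \<le> A0" "\<bar>B\<bar> \<le> B0" "\<bar>C\<bar> \<le> C0" "\<bar>x\<bar> \<le> H" "\<bar>y\<bar> \<le> H"
  shows "\<bar>(A * x + B * x ^ 2 + C * x ^ 3) - (A * y + B * y ^ 2 + C * y ^ 3)\<bar>
    \<le> (A0 + 2 * B0 * H + 3 * C0 * H ^ 2) * \<bar>x - y\<bar>"
proof -
  have H: "0 \<le> H" using assms by linarith
  have "\<bar>B * (x + y)\<bar> \<le> B0 * (2 * H)" unfolding abs_mult using assms by (intro mult_mono) auto
  moreover have "\<bar>C * (x * x + x * y + y * y)\<bar> \<le> C0 * (3 * H ^ 2)"
  proof -
    have "\<bar>x * x\<bar> \<le> H * H" "\<bar>x * y\<bar> \<le> H * H" "\<bar>y * y\<bar> \<le> H * H"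
      unfolding abs_mult using assms H by (intro mult_mono; linarith)+
    then have "\<bar>x * x + x * y + y * y\<bar> \<le> 3 * H ^ 2" unfolding power2_eq_square by linarith
    then show ?thesis unfolding abs_mult[of C] using assms by (intro mult_mono) auto
  qed
  ultimately have "\<bar>A + B * (x + y) + C * (x * x + x * y + y * y)\<bar> \<le> A0 + 2 * B0 * H + 3 * C0 * H ^ 2"
    using assms(1) abs_triangle_ineq[of "A + B * (x + y)" "C * (x * x + x * y + y * y)"]
      abs_triangle_ineq[of A "B * (x + y)"] by argo
  then have "\<bar>A + B * (x + y) + C * (x * x + x * y + y * y)\<bar> * \<bar>x - y\<bar> \<le> (A0 + 2 * B0 * H + 3 * C0 * H ^ 2) * \<bar>x - y\<bar>"
    by (rule mult_right_mono) simp
  moreover have "(A * x + B * x ^ 2 + C * x ^ 3) - (A * y + B * y ^ 2 + C * y ^ 3)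
    = (A + B * (x + y) + C * (x * x + x * y + y * y)) * (x - y)"
    by (simp add: algebra_simps power2_eq_square power3_eq_cube)
  ultimately show ?thesis by (simp add: abs_mult)
qed

section \<open>Uniqueness of the forced solution\<close>

text \<open>The integrating factor \<open>exp (- C * t)\<close> makes the product with
  \<open>D\<close> nonincreasing.\<close>

lemma gronwall_zero:
  fixes D :: "real \<Rightarrow> real"
  assumes D: "\<And>t. t \<in> {0..T} \<Longrightarrow> (D has_real_derivative D' t) (at t within {0..T})"
    and D': "\<And>t. t \<in> {0..T} \<Longrightarrow> D' t \<le> C * D t" and "D 0 = 0" and t: "t \<in> {0..T}"
  shows "D t \<le> 0"
proof -
  have "exp (- C * t) * D t \<le> exp (- C * 0) * D 0"
  proof (rule DERIV_nonpos_imp_decreasing_open[where f = "\<lambda>s. exp (- C * s) * D s"])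
    show "0 \<le> t" using t by simp
    show "continuous_on {0..t} (\<lambda>s. exp (- C * s) * D s)"
      using t by (intro continuous_intros continuous_on_subset[OF DERIV_continuous_on[OF D]]) auto
    fix s assume s: "0 < s" "s < t"
    then have "(D has_real_derivative D' s) (at s)"
      using D[of s] t at_within_Icc_at[of 0 s T] by auto
    then have "((\<lambda>s. exp (- C * s) * D s) has_real_derivative exp (- C * s) * (D' s - C * D s)) (at s)"
      by (auto intro!: derivative_eq_intros simp: algebra_simps)
    moreover have "exp (- C * s) * (D' s - C * D s) \<le> 0"
      using D'[of s] s t by (intro mult_nonneg_nonpos) auto
    ultimately show "\<exists>y. ((\<lambda>s. exp (- C * s) * D s) has_real_derivative y) (at s) \<and> y \<le> 0" by blast
  qed
  then show ?thesis using \<open>D 0 = 0\<close> by (simp add: mult_le_0_iff)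
qed

text \<open>The nonlinearity is only locally Lipschitz, but two given solutions are bounded on the
  compact interval. A Lipschitz constant depending on both solutions is enough for Gronwall, applied
  to the squared distance of positions and velocities.\<close>

lemma forced_solution_unique:
  assumes y: "forced_solution_on T n c d h \<omega> lam f \<Omega> \<epsilon> y0 v0 y"
    and z: "forced_solution_on T n c d h \<omega> lam f \<Omega> \<epsilon> y0 v0 z"
    and k: "k \<in> {1..n}" and t: "t \<in> {0..T}"
  shows "z k t = y k t"
proof -
  obtain vy wy where Y: "\<forall>k\<in>{1..n}. y k 0 = y0 k \<and> vy k 0 = v0 k \<and>
     (\<forall>t\<in>{0..T}. (y k has_real_derivative vy k t) (at t within {0..T}) \<and>
        (vy k has_real_derivative wy k t) (at t within {0..T}) \<and>
        wy k t + \<epsilon> * lam k * vy k t + (\<omega> k)^2 * y k t +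
          h k * (c * (\<Sum>i=1..n. y i t * h i)^2 + d / \<epsilon> * (\<Sum>i=1..n. y i t * h i)^3)
        = \<epsilon>^2 * f k * cos (\<Omega> * t))"
    using y unfolding forced_solution_on_def by blast
  obtain vz wz where Z: "\<forall>k\<in>{1..n}. z k 0 = y0 k \<and> vz k 0 = v0 k \<and>
     (\<forall>t\<in>{0..T}. (z k has_real_derivative vz k t) (at t within {0..T}) \<and>
        (vz k has_real_derivative wz k t) (at t within {0..T}) \<and>
        wz k t + \<epsilon> * lam k * vz k t + (\<omega> k)^2 * z k t +
          h k * (c * (\<Sum>i=1..n. z i t * h i)^2 + d / \<epsilon> * (\<Sum>i=1..n. z i t * h i)^3)
        = \<epsilon>^2 * f k * cos (\<Omega> * t))"
    using z unfolding forced_solution_on_def by blast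
  have dy: "(y k has_real_derivative vy k t) (at t within {0..T})"
    "(vy k has_real_derivative wy k t) (at t within {0..T})"
    "wy k t = \<epsilon>^2 * f k * cos (\<Omega> * t) - \<epsilon> * lam k * vy k t - (\<omega> k)^2 * y k t -
      h k * (c * (\<Sum>i=1..n. y i t * h i)^2 + d / \<epsilon> * (\<Sum>i=1..n. y i t * h i)^3)"
    if "k \<in> {1..n}" "t \<in> {0..T}" for k t
  proof -
    note eq = Y[THEN bspec, OF that(1), THEN conjunct2, THEN conjunct2, THEN bspec, OF that(2)]
    from eq show "(y k has_real_derivative vy k t) (at t within {0..T})" by blast
    from eq show "(vy k has_real_derivative wy k t) (at t within {0..T})" by blast
    show "wy k t = \<epsilon>^2 * f k * cos (\<Omega> * t) - \<epsilon> * lam k * vy k t - (\<omega> k)^2 * y k t -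
      h k * (c * (\<Sum>i=1..n. y i t * h i)^2 + d / \<epsilon> * (\<Sum>i=1..n. y i t * h i)^3)"
      unfolding eq[THEN conjunct2, THEN conjunct2, symmetric] by simp
  qed
  have dz: "(z k has_real_derivative vz k t) (at t within {0..T})"
    "(vz k has_real_derivative wz k t) (at t within {0..T})"
    "wz k t = \<epsilon>^2 * f k * cos (\<Omega> * t) - \<epsilon> * lam k * vz k t - (\<omega> k)^2 * z k t -
      h k * (c * (\<Sum>i=1..n. z i t * h i)^2 + d / \<epsilon> * (\<Sum>i=1..n. z i t * h i)^3)"
    if "k \<in> {1..n}" "t \<in> {0..T}" for k t
  proof -
    note eq = Z[THEN bspec, OF that(1), THEN conjunct2, THEN conjunct2, THEN bspec, OF that(2)]
    from eq show "(z k has_real_derivative vz k t) (at t within {0..T})" by blast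
    from eq show "(vz k has_real_derivative wz k t) (at t within {0..T})" by blast
    show "wz k t = \<epsilon>^2 * f k * cos (\<Omega> * t) - \<epsilon> * lam k * vz k t - (\<omega> k)^2 * z k t -
      h k * (c * (\<Sum>i=1..n. z i t * h i)^2 + d / \<epsilon> * (\<Sum>i=1..n. z i t * h i)^3)"
      unfolding eq[THEN conjunct2, THEN conjunct2, symmetric] by simp
  qed
  have cy: "continuous_on {0..T} (y k)" and cz: "continuous_on {0..T} (z k)" if "k \<in> {1..n}" for k
    by (rule DERIV_continuous_on[OF dy(1)[OF that]] DERIV_continuous_on[OF dz(1)[OF that]], assumption)+
  define Sy where "Sy t = (\<Sum>i=1..n. y i t * h i)" for t
  define Sz where "Sz t = (\<Sum>i=1..n. z i t * h i)" for t
  have "continuous_on {0..T} (\<lambda>t. (Sy t, Sz t))"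
    unfolding Sy_def Sz_def by (intro continuous_intros cy cz)
  then have "bounded ((\<lambda>t. (Sy t, Sz t)) ` {0..T})"
    by (intro compact_imp_bounded compact_continuous_image) auto
  then obtain H where H: "\<And>t. t \<in> {0..T} \<Longrightarrow> norm (Sy t, Sz t) \<le> H"
    unfolding bounded_iff by blast
  have HS: "\<bar>Sy t\<bar> \<le> H" "\<bar>Sz t\<bar> \<le> H" if "t \<in> {0..T}" for t
    using order_trans[OF norm_fst_le H[OF that]] order_trans[OF norm_snd_le H[OF that]] by auto
  define D where "D t = (\<Sum>k=1..n. (z k t - y k t)\<^sup>2 + (vz k t - vy k t)\<^sup>2)" for t
  define D' where "D' t = (\<Sum>k=1..n. 2 * (z k t - y k t) * (vz k t - vy k t) + 2 * (vz k t - vy k t) * (wz k t - wy k t))" for t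
  \<comment> \<open>This is the constant of \<open>cubic_lipschitz\<close> without linear term, with
    coefficients \<open>c\<close> and \<open>d / \<epsilon>\<close>.\<close>
  define M where "M = 2 * \<bar>c\<bar> * H + 3 * \<bar>d / \<epsilon>\<bar> * H\<^sup>2"
  define K where "K k = \<bar>\<epsilon> * lam k\<bar> + (\<omega> k)\<^sup>2 + \<bar>h k\<bar> * (M * (\<Sum>i=1..n. \<bar>h i\<bar>))" for k
  have comp: "\<bar>z k t - y k t\<bar> \<le> sqrt (D t)" "\<bar>vz k t - vy k t\<bar> \<le> sqrt (D t)" if "k \<in> {1..n}" for k t
  proof -
    have "(z k t - y k t)\<^sup>2 + (vz k t - vy k t)\<^sup>2 \<le> D t"
      unfolding D_def by (rule member_le_sum[OF that]) auto
    then have "(z k t - y k t)\<^sup>2 \<le> D t" "(vz k t - vy k t)\<^sup>2 \<le> D t"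
      using zero_le_power2[of "z k t - y k t"] zero_le_power2[of "vz k t - vy k t"] by linarith+
    then show "\<bar>z k t - y k t\<bar> \<le> sqrt (D t)" "\<bar>vz k t - vy k t\<bar> \<le> sqrt (D t)"
      using real_sqrt_le_mono by fastforce+
  qed
  have D0: "0 \<le> D t" for t by (auto simp: D_def intro: sum_nonneg)
  have S_diff: "\<bar>Sz t - Sy t\<bar> \<le> (\<Sum>i=1..n. \<bar>h i\<bar>) * sqrt (D t)" for t
  proof -
    have "Sz t - Sy t = (\<Sum>i=1..n. (z i t - y i t) * h i)"
      by (simp add: Sz_def Sy_def sum_subtractf algebra_simps)
    also have "\<bar>\<dots>\<bar> \<le> (\<Sum>i=1..n. \<bar>h i\<bar> * sqrt (D t))"
      using comp(1) by (intro order_trans[OF sum_abs] sum_mono) (auto simp: abs_mult mult.commute intro: mult_left_mono)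
    finally show ?thesis by (simp add: sum_distrib_right)
  qed
  have w_diff: "\<bar>wz k t - wy k t\<bar> \<le> K k * sqrt (D t)" if k: "k \<in> {1..n}" and t: "t \<in> {0..T}" for k t
  proof -
    define N where "N s = c * s\<^sup>2 + d / \<epsilon> * s ^ 3" for s
    have "\<bar>N (Sz t) - N (Sy t)\<bar> \<le> M * \<bar>Sz t - Sy t\<bar>"
      using cubic_lipschitz[of 0 0 c "\<bar>c\<bar>" "d / \<epsilon>" "\<bar>d / \<epsilon>\<bar>" "Sz t" H "Sy t"] HS[OF t]
      by (simp add: N_def M_def)
    also have "\<dots> \<le> M * ((\<Sum>i=1..n. \<bar>h i\<bar>) * sqrt (D t))"
      using S_diff HS(1)[OF t] by (intro mult_left_mono) (auto simp: M_def)
    finally have "\<bar>h k * (N (Sz t) - N (Sy t))\<bar> \<le> \<bar>h k\<bar> * (M * (\<Sum>i=1..n. \<bar>h i\<bar>)) * sqrt (D t)"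
      unfolding abs_mult by (simp add: mult.assoc mult_left_mono)
    moreover have "\<bar>\<epsilon> * lam k * (vz k t - vy k t)\<bar> \<le> \<bar>\<epsilon> * lam k\<bar> * sqrt (D t)"
      unfolding abs_mult[of "\<epsilon> * lam k"] by (intro mult_left_mono comp k) auto
    moreover have "\<bar>(\<omega> k)\<^sup>2 * (z k t - y k t)\<bar> \<le> (\<omega> k)\<^sup>2 * sqrt (D t)"
      using mult_left_mono[OF comp(1)[OF k], of "(\<omega> k)\<^sup>2" t] by (simp add: abs_mult)
    moreover have "wz k t - wy k t = - (\<epsilon> * lam k * (vz k t - vy k t)) - (\<omega> k)\<^sup>2 * (z k t - y k t) - h k * (N (Sz t) - N (Sy t))"
      unfolding dz(3)[OF k t] dy(3)[OF k t] N_def Sz_def Sy_def by (simp add: algebra_simps)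
    ultimately show ?thesis unfolding K_def distrib_right by linarith
  qed
  have "D t \<le> 0"
  proof (rule gronwall_zero[OF _ _ _ t])
    show "(D has_real_derivative D' t) (at t within {0..T})" if "t \<in> {0..T}" for t
      unfolding D_def[abs_def] D'_def
      using that by (intro DERIV_sum) (auto intro!: derivative_eq_intros dy(1,2) dz(1,2) simp: algebra_simps)
    show "D 0 = 0" using Y Z by (simp add: D_def)
    \<comment> \<open>In each mode, the product of position and velocity differences costs
      \<open>2 * D t\<close> and that of velocity and acceleration differences
      \<open>2 * K k * D t\<close>.\<close>
    show "D' t \<le> (\<Sum>k=1..n. 2 + 2 * K k) * D t" if t: "t \<in> {0..T}" for t
      unfolding D'_def sum_distrib_right
    proof (rule sum_mono)
      fix k assume k: "k \<in> {1..n}"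
      have prod: "a * b \<le> r * D t" if "\<bar>a\<bar> \<le> sqrt (D t)" "\<bar>b\<bar> \<le> r * sqrt (D t)" for a b r
      proof -
        have "a * b \<le> \<bar>a\<bar> * \<bar>b\<bar>" by (metis abs_ge_self abs_mult)
        also have "\<dots> \<le> sqrt (D t) * (r * sqrt (D t))" using that D0 by (intro mult_mono) auto
        also have "\<dots> = r * D t" using D0[of t] by simp
        finally show ?thesis .
      qed
      have "(z k t - y k t) * (vz k t - vy k t) \<le> 1 * D t"
        using comp[OF k] by (intro prod) auto
      moreover have "(vz k t - vy k t) * (wz k t - wy k t) \<le> K k * D t"
        using comp[OF k] w_diff[OF k t] by (intro prod) auto
      ultimately show "2 * (z k t - y k t) * (vz k t - vy k t) + 2 * (vz k t - vy k t) * (wz k t - wy k t) \<le> (2 + 2 * K k) * D t"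
        unfolding distrib_right by linarith
    qed
  qed
  then show ?thesis using comp(1)[OF k, of t] D0[of t] by simp
qed

section \<open>Expansion of the response and control of its remainder\<close>

text \<open>Here \<open>s\<close> and \<open>co\<close> stand for the sine and cosine of \<Omega> t,
  \<open>P1\<close> and \<open>P2\<close> for derivatives of the corrector in the phase,
  \<open>\<rho>1\<close> and \<open>\<rho>2\<close> for time derivatives of the remainder, and
  \<open>\<epsilon> * (m * s + \<epsilon> * Q)\<close> for the sum inside the nonlinearity. With
  \<Omega>^2 = w^2 + 2 w \<epsilon> \<sigma> + \<epsilon>^2 \<sigma>^2, order \<epsilon> cancels
  because \<open>\<delta> = 0\<close> or \<open>\<nu> = w\<close>, order \<epsilon>^2 cancels by the
  corrector equation, and all higher orders are collected in \<open>\<rho>2\<close>.\<close>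

lemma modal_residual:
  fixes w \<nu> \<epsilon> :: real
  assumes corr: "w\<^sup>2 * P2 + \<nu>\<^sup>2 * P = (f - \<delta> * l * w) * co + (2 * w * \<sigma> * \<delta>) * s - (h * c * m\<^sup>2 * s ^ 2 + h * d * m ^ 3 * s ^ 3)"
    and \<delta>: "\<delta> = 0 \<or> \<nu> = w" and \<Omega>: "\<Omega> = w + \<epsilon> * \<sigma>" and \<epsilon>: "\<epsilon> \<noteq> 0"
    and \<rho>2: "\<rho>2 = - \<nu>\<^sup>2 * \<rho> + \<epsilon> * (\<delta> * \<sigma>\<^sup>2 * s - (2 * w * \<sigma> + \<epsilon> * \<sigma>\<^sup>2) * P2 - \<delta> * l * \<sigma> * co - l * (\<Omega> * P1 + \<rho>1)
      - h * ((2 * c * (m * s) + 3 * d * (m * s)\<^sup>2) * Q + \<epsilon> * (c + 3 * d * (m * s)) * Q ^ 2 + \<epsilon>\<^sup>2 * d * Q ^ 3))"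
  shows "(- (\<epsilon> * \<delta> * \<Omega>\<^sup>2 * s) + \<epsilon>\<^sup>2 * (\<Omega>\<^sup>2 * P2 + \<rho>2)) + \<epsilon> * l * (\<epsilon> * \<delta> * \<Omega> * co + \<epsilon>\<^sup>2 * (\<Omega> * P1 + \<rho>1))
    + \<nu>\<^sup>2 * (\<epsilon> * \<delta> * s + \<epsilon>\<^sup>2 * (P + \<rho>))
    + h * (c * (\<epsilon> * (m * s + \<epsilon> * Q))\<^sup>2 + d / \<epsilon> * (\<epsilon> * (m * s + \<epsilon> * Q)) ^ 3) = \<epsilon>\<^sup>2 * f * co" (is "?lhs = _")
proof -
  \<comment> \<open>The factor 1/\<epsilon> on the cubic term puts it at the same order \<epsilon>^2
    as the quadratic term.\<close>
  have cube: "d / \<epsilon> * (\<epsilon> * X) ^ 3 = \<epsilon>\<^sup>2 * (d * X ^ 3)" for X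
    using \<epsilon> by (simp add: power2_eq_square power3_eq_cube)
  have "\<nu>\<^sup>2 * (\<epsilon> * \<delta> * s) = w\<^sup>2 * (\<epsilon> * \<delta> * s)" using \<delta> by auto
  then have "?lhs = \<epsilon>\<^sup>2 * f * co + \<epsilon>\<^sup>2 * ((w\<^sup>2 * P2 + \<nu>\<^sup>2 * P) - ((f - \<delta> * l * w) * co + (2 * w * \<sigma> * \<delta>) * s - (h * c * m\<^sup>2 * s ^ 2 + h * d * m ^ 3 * s ^ 3)))"
    unfolding cube \<rho>2 \<Omega> distrib_left[of "\<nu>\<^sup>2"] by (simp add: algebra_simps power2_eq_square power3_eq_cube)
  then show ?thesis unfolding corr by simp
qed

lemma finite_family_bound:
  fixes b :: "'a \<Rightarrow> real"
  assumes "finite K"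
  obtains M where "M \<ge> 0" "\<And>k. k \<in> K \<Longrightarrow> b k \<le> M"
proof
  show "(\<Sum>k\<in>K. \<bar>b k\<bar>) \<ge> 0" by (simp add: sum_nonneg)
  show "b k \<le> (\<Sum>k\<in>K. \<bar>b k\<bar>)" if "k \<in> K" for k
    using member_le_sum[OF that, of "\<lambda>k. \<bar>b k\<bar>"] assms by auto
qed

text \<open>The order of quantifiers carries the uniformity: \<open>\<gamma>\<close> and
  \<open>C\<close> are fixed before \<epsilon> and the initial data, which enter only through
  \<open>C0\<close>. The leading term is a sine, starting at position zero with positive velocity if
  \<open>a\<close> is positive, as the phase of the maximal solution requires.\<close>

lemma near_resonant_solution:
  fixes n :: nat and c d a \<sigma> C0 :: real and h \<omega> lam f :: "nat \<Rightarrow> real"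
  defines "\<Omega> \<equiv> excitation_freq (\<omega> 1) \<sigma>" and "\<delta> \<equiv> \<lambda>k. if k = 1 then a else 0"
  assumes n: "n \<ge> 1" and \<omega>: "\<And>k. k \<in> {1..n} \<Longrightarrow> \<omega> k > 0"
    and nonres: "\<And>k. k \<in> {1..n} \<Longrightarrow> \<omega> k \<noteq> 2 * \<omega> 1 \<and> \<omega> k \<noteq> 3 * \<omega> 1 \<and> (k \<noteq> 1 \<longrightarrow> \<omega> k \<noteq> \<omega> 1)"
    and amp: "f 1 = lam 1 * \<omega> 1 * a"
    and det: "\<sigma> = 3 * (d * h 1 ^ 4) * a\<^sup>2 / (8 * \<omega> 1)"
  obtains \<gamma> C where "\<gamma> > 0"
    "\<And>\<epsilon> y0 v0. 0 < \<epsilon> \<Longrightarrow> \<epsilon> \<le> 1 \<Longrightarrow> (\<And>k. k \<in> {1..n} \<Longrightarrow> \<bar>y0 k\<bar> \<le> C0 * \<epsilon>\<^sup>2) \<Longrightarrow>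
      (\<And>k. k \<in> {1..n} \<Longrightarrow> \<bar>v0 k - \<epsilon> * \<omega> 1 * \<delta> k\<bar> \<le> C0 * \<epsilon>\<^sup>2) \<Longrightarrow>
      \<exists>r r' r''. forced_solution_on (\<gamma> / \<epsilon>) n c d h \<omega> lam f (\<Omega> \<epsilon>) \<epsilon> y0 v0
          (\<lambda>k t. \<epsilon> * \<delta> k * sin (\<Omega> \<epsilon> * t) + \<epsilon>\<^sup>2 * r k t) \<and>
        (\<forall>k\<in>{1..n}. continuous_on {0..\<gamma> / \<epsilon>} (r'' k) \<and> (\<forall>t\<in>{0..\<gamma> / \<epsilon>}.
          (r k has_real_derivative r' k t) (at t within {0..\<gamma> / \<epsilon>}) \<and>
          (r' k has_real_derivative r'' k t) (at t within {0..\<gamma> / \<epsilon>}) \<and>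
          \<bar>r k t\<bar> \<le> C \<and> \<bar>r' k t\<bar> \<le> C \<and> \<bar>r'' k t\<bar> \<le> C))"
proof -
  define K where "K = {1..n}"
  have K: "finite K" "1 \<in> K" using n by (auto simp: K_def)
  have \<omega>1: "\<omega> 1 > 0" using \<omega> K(2) by (simp add: K_def)
  \<comment> \<open>To leading order the sum inside the nonlinearity is
    \<open>\<epsilon> * m * sin (\<Omega> \<epsilon> * t)\<close>, since only mode 1
    contributes.\<close>
  define m where "m = h 1 * a"
  \<comment> \<open>Packing the corrector property of a mode into one predicate allows the choice of
    correctors for all modes at once.\<close>
  define corr where "corr k P P' P'' C \<longleftrightarrow>
    (\<forall>\<theta>. (P has_real_derivative P' \<theta>) (at \<theta>)) \<and> (\<forall>\<theta>. (P' has_real_derivative P'' \<theta>) (at \<theta>)) \<and>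
    continuous_on UNIV P'' \<and> (\<forall>\<theta>. \<bar>P \<theta>\<bar> \<le> C \<and> \<bar>P' \<theta>\<bar> \<le> C \<and> \<bar>P'' \<theta>\<bar> \<le> C) \<and>
    (\<forall>\<theta>. (\<omega> 1)\<^sup>2 * P'' \<theta> + (\<omega> k)\<^sup>2 * P \<theta> = (f k - \<delta> k * lam k * \<omega> 1) * cos \<theta> + (2 * \<omega> 1 * \<sigma> * \<delta> k) * sin \<theta>
      - (h k * c * m\<^sup>2 * sin \<theta> ^ 2 + h k * d * m ^ 3 * sin \<theta> ^ 3))" for k P P' P'' C
  have "\<exists>P P' P'' C. corr k P P' P'' C" if k: "k \<in> K" for k
    unfolding corr_def
  proof (rule nonresonant_corrector)
    have pos: "\<omega> k > 0" using \<omega> k by (simp add: K_def)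
    then show "\<omega> k \<noteq> 0" by simp
    have "\<omega> k \<noteq> 2 * \<omega> 1" "\<omega> k \<noteq> 3 * \<omega> 1" using nonres k by (auto simp: K_def)
    then have "(\<omega> k)\<^sup>2 \<noteq> (2 * \<omega> 1)\<^sup>2" "(\<omega> k)\<^sup>2 \<noteq> (3 * \<omega> 1)\<^sup>2"
      using pos \<omega>1 by (auto simp only: power2_eq_iff)
    then show "(\<omega> k)\<^sup>2 \<noteq> 4 * (\<omega> 1)\<^sup>2" "(\<omega> k)\<^sup>2 \<noteq> 9 * (\<omega> 1)\<^sup>2" by (simp_all add: power_mult_distrib)
    \<comment> \<open>Only mode 1 is resonant. Its cosine coefficient is forcing against damping,
      zero by \<open>amp\<close>; its sine coefficient is the detuning against 3/4 of the cubic
      coefficient, balanced by \<open>det\<close>.\<close>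
    assume "(\<omega> k)\<^sup>2 = (\<omega> 1)\<^sup>2"
    then have "\<omega> k = \<omega> 1" using pos \<omega>1 by (simp add: power2_eq_iff_nonneg)
    then have "k = 1" using nonres k by (auto simp: K_def)
    then show "f k - \<delta> k * lam k * \<omega> 1 = 0 \<and> 2 * \<omega> 1 * \<sigma> * \<delta> k = 3 * (h k * d * m ^ 3) / 4"
      using \<omega>1 amp by (simp add: \<delta>_def det m_def field_simps power2_eq_square power3_eq_cube power4_eq_xxxx)
  qed
  then obtain P P' P'' Cc where "\<And>k. k \<in> K \<Longrightarrow> corr k (P k) (P' k) (P'' k) (Cc k)" by metis
  note corr = this[unfolded corr_def]
  obtain Cm where Cm0: "Cm \<ge> 0" and Cm: "\<And>k. k \<in> K \<Longrightarrow> Cc k \<le> Cm"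
    using finite_family_bound[OF K(1), of Cc] by blast
  have P_le: "\<bar>P k \<theta>\<bar> \<le> Cm" "\<bar>P' k \<theta>\<bar> \<le> Cm" "\<bar>P'' k \<theta>\<bar> \<le> Cm" if "k \<in> K" for k \<theta>
    using corr[OF that] Cm[OF that] by (meson order_trans)+
  have contP: "continuous_on S (\<lambda>t. P k (x t))" "continuous_on S (\<lambda>t. P' k (x t))" "continuous_on S (\<lambda>t. P'' k (x t))"
    if "k \<in> K" "continuous_on S x" for k x and S :: "real set"
  proof -
    have "continuous_on UNIV (P k)" "continuous_on UNIV (P' k)" "continuous_on UNIV (P'' k)"
      using corr[OF that(1)] by (auto intro: DERIV_isCont continuous_at_imp_continuous_on)
    then show "continuous_on S (\<lambda>t. P k (x t))" "continuous_on S (\<lambda>t. P' k (x t))" "continuous_on S (\<lambda>t. P'' k (x t))"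
      using that(2) by (auto intro: continuous_on_compose2)
  qed
  \<comment> \<open>A bound for the driving frequency, valid for all \<epsilon> in (0, 1].\<close>
  define W where "W = \<omega> 1 + \<bar>\<sigma>\<bar>"
  \<comment> \<open>\<open>R0\<close> bounds the initial remainder in the norm of
    \<open>oscillators_solution_exists\<close>: the data errors divided by \<epsilon>^2, the initial
    values of the corrector, and the effect of the detuning on the initial velocity.\<close>
  obtain R0 where R0: "\<And>k. k \<in> K \<Longrightarrow> C0 + Cm + (C0 + \<bar>a\<bar> * \<bar>\<sigma>\<bar> + W * Cm) / \<omega> k \<le> R0" and R00: "R0 \<ge> 0"
    using finite_family_bound[OF K(1), of "\<lambda>k. C0 + Cm + (C0 + \<bar>a\<bar> * \<bar>\<sigma>\<bar> + W * Cm) / \<omega> k"] by blast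
  \<comment> \<open>The extra 1 is room for the drift of the remainder, at most
    \<open>\<gamma> * B\<close>, over the whole interval.\<close>
  define R where "R = R0 + 1"
  define hs where "hs = (\<Sum>i\<in>K. \<bar>h i\<bar>)"
  \<comment> \<open>\<open>H\<close> bounds the second-order jump \<open>Q\<close> as long as the
    remainder stays in the ball of radius \<open>R\<close>.\<close>
  define H where "H = hs * (Cm + R)"
  have hs: "hs \<ge> 0" by (simp add: hs_def sum_nonneg)
  have H: "H \<ge> 0" using hs Cm0 R00 by (simp add: H_def R_def)
  \<comment> \<open>The Lipschitz constant that \<open>cubic_lipschitz\<close> gives for the
    nonlinear part of the remainder equation, with the powers of \<epsilon> estimated by 1.\<close>
  define Lq where "Lq = (2 * \<bar>c\<bar> * \<bar>m\<bar> + 3 * \<bar>d\<bar> * m\<^sup>2) + 2 * (\<bar>c\<bar> + 3 * \<bar>d\<bar> * \<bar>m\<bar>) * H + 3 * \<bar>d\<bar> * H\<^sup>2"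
  have Lq: "Lq \<ge> 0" using H by (simp add: Lq_def)
  \<comment> \<open>The summands bound the terms of \<open>G k\<close> one by one, in the order in
    which they occur in its definition below.\<close>
  define b where "b k = \<bar>a\<bar> * \<sigma>\<^sup>2 + (2 * \<omega> 1 * \<bar>\<sigma>\<bar> + \<sigma>\<^sup>2) * Cm + \<bar>a\<bar> * \<bar>lam k\<bar> * \<bar>\<sigma>\<bar> + \<bar>lam k\<bar> * (W * Cm + \<omega> k * R)
    + \<bar>h k\<bar> * (Lq * H)" for k
  obtain B where B0: "B \<ge> 0" and B: "\<And>k. k \<in> K \<Longrightarrow> b k / \<omega> k \<le> B"
    using finite_family_bound[OF K(1), of "\<lambda>k. b k / \<omega> k"] by blast
  obtain L where L0: "L \<ge> 0" and L: "\<And>k. k \<in> K \<Longrightarrow> (\<bar>lam k\<bar> * \<omega> k + \<bar>h k\<bar> * (Lq * hs)) / \<omega> k \<le> L"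
    using finite_family_bound[OF K(1), of "\<lambda>k. (\<bar>lam k\<bar> * \<omega> k + \<bar>h k\<bar> * (Lq * hs)) / \<omega> k"] by blast
  \<comment> \<open>The bounds for the remainder and its two derivatives are nonnegative, so a bound
    for their sum dominates each of them.\<close>
  obtain C where C: "\<And>k. k \<in> K \<Longrightarrow> (Cm + R) + (W * Cm + \<omega> k * R) + (W\<^sup>2 * Cm + (\<omega> k)\<^sup>2 * R + \<omega> k * B) \<le> C"
    using finite_family_bound[OF K(1), of "\<lambda>k. (Cm + R) + (W * Cm + \<omega> k * R) + (W\<^sup>2 * Cm + (\<omega> k)\<^sup>2 * R + \<omega> k * B)"] by blast
  \<comment> \<open>One choice secures both invariance of the ball,
    \<open>\<gamma> * B \<le> 1\<close>, and contraction, \<open>\<gamma> * L < 1\<close>.\<close>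
  define \<gamma> where "\<gamma> = 1 / (B + L + 1)"
  have \<gamma>: "\<gamma> > 0" "\<gamma> * B \<le> 1" "\<gamma> * L < 1" using B0 L0 by (auto simp: \<gamma>_def field_simps)
  show ?thesis
  proof (rule that[OF \<gamma>(1), of C])
    fix \<epsilon> y0 v0
    assume \<epsilon>: "0 < \<epsilon>" "\<epsilon> \<le> 1"
      and y0: "\<And>k. k \<in> {1..n} \<Longrightarrow> \<bar>y0 k\<bar> \<le> C0 * \<epsilon>\<^sup>2"
      and v0: "\<And>k. k \<in> {1..n} \<Longrightarrow> \<bar>v0 k - \<epsilon> * \<omega> 1 * \<delta> k\<bar> \<le> C0 * \<epsilon>\<^sup>2"
    define w where "w = \<Omega> \<epsilon>"
    have w: "w = \<omega> 1 + \<epsilon> * \<sigma>" by (simp add: w_def \<Omega>_def excitation_freq_def)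
    have \<epsilon>\<sigma>: "\<bar>\<epsilon> * \<sigma>\<bar> \<le> \<bar>\<sigma>\<bar>" using \<epsilon> by (simp add: abs_mult mult_left_le_one_le)
    have w_le: "\<bar>w\<bar> \<le> W" using \<epsilon>\<sigma> \<omega>1 by (simp add: w W_def)
    define T where "T = \<gamma> / \<epsilon>"
    \<comment> \<open>The factor \<epsilon> of the perturbation cancels against the length of the
      interval, so that the conditions on \<open>T\<close> no longer involve \<epsilon>.\<close>
    have T: "T \<ge> 0" "T * (\<epsilon> * x) = \<gamma> * x" for x using \<epsilon> \<gamma>(1) by (auto simp: T_def)
    \<comment> \<open>\<open>Q\<close>, \<open>N\<close> and \<open>G\<close> reproduce the terms of
      \<open>modal_residual\<close>: the jump at order \<epsilon>^2, the nonlinear terms beyond the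
      corrector equation, and the whole perturbation divided by \<epsilon>.\<close>
    define Q where "Q t x = (\<Sum>i\<in>K. h i * (P i (w * t) + x i))" for t and x :: "nat \<Rightarrow> real"
    define N where "N t q = (2 * c * (m * sin (w * t)) + 3 * d * (m * sin (w * t))\<^sup>2) * q
      + \<epsilon> * (c + 3 * d * (m * sin (w * t))) * q ^ 2 + \<epsilon>\<^sup>2 * d * q ^ 3" for t q
    define G where "G k t x v = \<delta> k * \<sigma>\<^sup>2 * sin (w * t) - (2 * \<omega> 1 * \<sigma> + \<epsilon> * \<sigma>\<^sup>2) * P'' k (w * t) - \<delta> k * lam k * \<sigma> * cos (w * t)
      - lam k * (w * P' k (w * t) + v k) - h k * N t (Q t x)" for k t and x v :: "nat \<Rightarrow> real"
    have N_lip: "\<bar>N t q - N t q'\<bar> \<le> Lq * \<bar>q - q'\<bar>" if "\<bar>q\<bar> \<le> H" "\<bar>q'\<bar> \<le> H" for t q q'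
    proof -
      have ms: "\<bar>m * sin (w * t)\<bar> \<le> \<bar>m\<bar>"
        by (simp add: abs_mult mult_left_le)
      have "(m * sin (w * t))\<^sup>2 \<le> m\<^sup>2" using ms by (simp only: abs_le_square_iff)
      then have "\<bar>2 * c * (m * sin (w * t))\<bar> \<le> 2 * \<bar>c\<bar> * \<bar>m\<bar>" "\<bar>3 * d * (m * sin (w * t))\<^sup>2\<bar> \<le> 3 * \<bar>d\<bar> * m\<^sup>2"
        "\<bar>3 * d * (m * sin (w * t))\<bar> \<le> 3 * \<bar>d\<bar> * \<bar>m\<bar>"
        unfolding abs_mult[of "2 * c"] abs_mult[of "3 * d"] using ms by (auto simp: abs_mult intro!: mult_left_mono)
      then have "\<bar>2 * c * (m * sin (w * t)) + 3 * d * (m * sin (w * t))\<^sup>2\<bar> \<le> 2 * \<bar>c\<bar> * \<bar>m\<bar> + 3 * \<bar>d\<bar> * m\<^sup>2"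
        "\<bar>c + 3 * d * (m * sin (w * t))\<bar> \<le> \<bar>c\<bar> + 3 * \<bar>d\<bar> * \<bar>m\<bar>"
        by (meson abs_triangle_ineq add_mono order_trans order_refl)+
      moreover from this(2) have "\<bar>\<epsilon> * (c + 3 * d * (m * sin (w * t)))\<bar> \<le> \<bar>c\<bar> + 3 * \<bar>d\<bar> * \<bar>m\<bar>"
        using \<epsilon> mult_mono[of "\<bar>\<epsilon>\<bar>" 1 "\<bar>c + 3 * d * (m * sin (w * t))\<bar>"] by (simp add: abs_mult)
      moreover have "\<bar>\<epsilon>\<^sup>2 * d\<bar> \<le> \<bar>d\<bar>"
        using \<epsilon> power_le_one[of \<epsilon> 2] by (simp add: abs_mult mult_left_le_one_le)
      ultimately show ?thesis
        unfolding N_def Lq_def using that by (intro cubic_lipschitz)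
    qed
    have Q_le: "\<bar>Q t x\<bar> \<le> H" if "\<And>i. i \<in> K \<Longrightarrow> \<bar>x i\<bar> \<le> R" for t x
    proof -
      have "\<bar>P i (w * t) + x i\<bar> \<le> Cm + R" if "i \<in> K" for i
        using P_le(1)[OF that] \<open>\<And>i. i \<in> K \<Longrightarrow> \<bar>x i\<bar> \<le> R\<close>[OF that] by (meson abs_triangle_ineq add_mono order_trans)
      then have "\<bar>Q t x\<bar> \<le> (\<Sum>i\<in>K. \<bar>h i\<bar> * (Cm + R))"
        unfolding Q_def by (intro order_trans[OF sum_abs] sum_mono) (simp add: abs_mult mult_left_mono)
      then show ?thesis by (simp add: H_def hs_def sum_distrib_right)
    qed
    have N_le: "\<bar>N t (Q t x)\<bar> \<le> Lq * H" if "\<And>i. i \<in> K \<Longrightarrow> \<bar>x i\<bar> \<le> R" for t x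
    proof -
      \<comment> \<open>\<open>N t\<close> vanishes at 0, so its Lipschitz estimate is also a size
        estimate.\<close>
      have "\<bar>N t (Q t x) - N t 0\<bar> \<le> Lq * \<bar>Q t x - 0\<bar>" using Q_le[OF that] H by (intro N_lip) auto
      also have "\<dots> \<le> Lq * H" using Q_le[OF that] Lq by (intro mult_left_mono) auto
      finally show ?thesis by (simp add: N_def)
    qed
    have Q_lip: "\<bar>Q t x - Q t x'\<bar> \<le> hs * \<eta>" if "\<And>i. i \<in> K \<Longrightarrow> \<bar>x i - x' i\<bar> \<le> \<eta>" for t x x' \<eta>
    proof -
      have "Q t x - Q t x' = (\<Sum>i\<in>K. h i * (x i - x' i))"
        by (simp add: Q_def sum_subtractf[symmetric] algebra_simps)
      also have "\<bar>\<dots>\<bar> \<le> (\<Sum>i\<in>K. \<bar>h i\<bar> * \<eta>)"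
        using that by (intro order_trans[OF sum_abs] sum_mono) (simp add: abs_mult mult_left_mono)
      finally show ?thesis by (simp add: hs_def sum_distrib_right)
    qed
    have G_le: "\<bar>G k t x v\<bar> \<le> \<omega> k * B" if k: "k \<in> K" and x: "\<And>i. i \<in> K \<Longrightarrow> \<bar>x i\<bar> \<le> R" and v: "\<And>i. i \<in> K \<Longrightarrow> \<bar>v i\<bar> \<le> \<omega> i * R" for k t x v
    proof -
      have \<delta>a: "\<bar>\<delta> k\<bar> \<le> \<bar>a\<bar>" by (simp add: \<delta>_def)
      have "\<bar>\<delta> k * \<sigma>\<^sup>2 * sin (w * t)\<bar> \<le> \<bar>a\<bar> * \<sigma>\<^sup>2 * 1"
        unfolding abs_mult using \<delta>a by (intro mult_mono) auto
      moreover have "\<bar>(2 * \<omega> 1 * \<sigma> + \<epsilon> * \<sigma>\<^sup>2) * P'' k (w * t)\<bar> \<le> (2 * \<omega> 1 * \<bar>\<sigma>\<bar> + \<sigma>\<^sup>2) * Cm"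
      proof -
        have "\<bar>\<epsilon> * \<sigma>\<^sup>2\<bar> \<le> \<sigma>\<^sup>2" using \<epsilon> by (simp add: abs_mult mult_left_le_one_le)
        moreover have "\<bar>2 * \<omega> 1 * \<sigma>\<bar> = 2 * \<omega> 1 * \<bar>\<sigma>\<bar>" using \<omega>1 by (simp add: abs_mult)
        ultimately have "\<bar>2 * \<omega> 1 * \<sigma> + \<epsilon> * \<sigma>\<^sup>2\<bar> \<le> 2 * \<omega> 1 * \<bar>\<sigma>\<bar> + \<sigma>\<^sup>2"
          by (metis abs_triangle_ineq add_left_mono order_trans)
        then show ?thesis unfolding abs_mult[of _ "P'' k (w * t)"] using P_le[OF k] \<omega>1 by (intro mult_mono) auto
      qed
      moreover have "\<bar>\<delta> k * lam k * \<sigma> * cos (w * t)\<bar> \<le> \<bar>a\<bar> * \<bar>lam k\<bar> * \<bar>\<sigma>\<bar> * 1"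
        unfolding abs_mult using \<delta>a by (intro mult_mono) auto
      moreover have "\<bar>lam k * (w * P' k (w * t) + v k)\<bar> \<le> \<bar>lam k\<bar> * (W * Cm + \<omega> k * R)"
      proof -
        have "\<bar>w * P' k (w * t)\<bar> \<le> W * Cm" unfolding abs_mult using w_le P_le[OF k] by (intro mult_mono) auto
        then have "\<bar>w * P' k (w * t) + v k\<bar> \<le> W * Cm + \<omega> k * R" using v[OF k] by (meson abs_triangle_ineq add_mono order_trans)
        then show ?thesis unfolding abs_mult[of "lam k"] by (intro mult_left_mono) auto
      qed
      moreover have "\<bar>h k * N t (Q t x)\<bar> \<le> \<bar>h k\<bar> * (Lq * H)"
        unfolding abs_mult using N_le[OF x] by (intro mult_left_mono) auto
      moreover have "\<bar>x1 - x2 - x3 - x4 - x5\<bar> \<le> \<bar>x1\<bar> + \<bar>x2\<bar> + \<bar>x3\<bar> + \<bar>x4\<bar> + \<bar>x5\<bar>" for x1 x2 x3 x4 x5 :: real by linarith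
      ultimately have "\<bar>G k t x v\<bar> \<le> b k"
        unfolding G_def b_def mult_1_right by (meson add_mono order_trans)
      also have "\<dots> \<le> \<omega> k * B" using B[OF k] \<omega>[of k] k by (simp add: K_def field_simps)
      finally show ?thesis .
    qed
    have G_lip: "\<bar>G k t x v - G k t x' v'\<bar> \<le> \<omega> k * (L * \<eta>)"
      if k: "k \<in> K" and "\<And>i. i \<in> K \<Longrightarrow> \<bar>x i\<bar> \<le> R" "\<And>i. i \<in> K \<Longrightarrow> \<bar>x' i\<bar> \<le> R"
        and x: "\<And>i. i \<in> K \<Longrightarrow> \<bar>x i - x' i\<bar> \<le> \<eta>" and v: "\<And>i. i \<in> K \<Longrightarrow> \<bar>v i - v' i\<bar> \<le> \<omega> i * \<eta>" for k t x v x' v' \<eta>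
    proof -
      have \<eta>: "0 \<le> \<eta>" using order_trans[OF abs_ge_zero x[OF k]] .
      have "\<bar>N t (Q t x) - N t (Q t x')\<bar> \<le> Lq * \<bar>Q t x - Q t x'\<bar>"
        using that Q_le by (intro N_lip) auto
      also have "\<dots> \<le> Lq * (hs * \<eta>)" using Q_lip[OF x] Lq by (intro mult_left_mono) auto
      finally have "\<bar>h k * (N t (Q t x) - N t (Q t x'))\<bar> \<le> \<bar>h k\<bar> * (Lq * (hs * \<eta>))"
        unfolding abs_mult by (intro mult_left_mono) auto
      moreover have "\<bar>lam k * (v k - v' k)\<bar> \<le> \<bar>lam k\<bar> * (\<omega> k * \<eta>)"
        unfolding abs_mult using v[OF k] by (intro mult_left_mono) auto
      moreover have "G k t x v - G k t x' v' = - (lam k * (v k - v' k)) - h k * (N t (Q t x) - N t (Q t x'))"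
        by (simp add: G_def algebra_simps)
      ultimately have "\<bar>G k t x v - G k t x' v'\<bar> \<le> \<bar>lam k\<bar> * (\<omega> k * \<eta>) + \<bar>h k\<bar> * (Lq * (hs * \<eta>))" by linarith
      also have "\<dots> = (\<bar>lam k\<bar> * \<omega> k + \<bar>h k\<bar> * (Lq * hs)) * \<eta>" by (simp add: algebra_simps)
      also have "\<dots> \<le> (\<omega> k * L) * \<eta>" using L[OF k] \<omega>[of k] k \<eta> by (intro mult_right_mono) (simp_all add: K_def field_simps)
      finally show ?thesis by (simp add: mult.assoc)
    qed
    have G_cont: "continuous_on S (\<lambda>t. G k t (\<lambda>i. x i t) (\<lambda>i. v i t))"
      if "k \<in> K" "\<And>i. i \<in> K \<Longrightarrow> continuous_on S (x i)" "\<And>i. i \<in> K \<Longrightarrow> continuous_on S (v i)" for k x v and S :: "real set"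
      unfolding G_def N_def Q_def using that by (intro continuous_intros contP) auto
    \<comment> \<open>The initial values are those of the remainder: data minus leading term,
      divided by \<epsilon>^2, minus the corrector at phase 0.\<close>
    obtain x v where x0: "\<And>k. k \<in> K \<Longrightarrow> x k 0 = y0 k / \<epsilon>\<^sup>2 - P k 0"
      and vv0: "\<And>k. k \<in> K \<Longrightarrow> v k 0 = (v0 k - \<epsilon> * \<delta> k * w) / \<epsilon>\<^sup>2 - w * P' k 0"
      and x_le: "\<And>k t. k \<in> K \<Longrightarrow> t \<in> {0..T} \<Longrightarrow> \<bar>x k t\<bar> \<le> R"
      and v_le: "\<And>k t. k \<in> K \<Longrightarrow> t \<in> {0..T} \<Longrightarrow> \<bar>v k t\<bar> \<le> \<omega> k * R"
      and dx: "\<And>k t. k \<in> K \<Longrightarrow> t \<in> {0..T} \<Longrightarrow> (x k has_real_derivative v k t) (at t within {0..T})"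
      and dv: "\<And>k t. k \<in> K \<Longrightarrow> t \<in> {0..T} \<Longrightarrow> (v k has_real_derivative
       - (\<omega> k)\<^sup>2 * x k t + \<epsilon> * G k t (\<lambda>i. x i t) (\<lambda>i. v i t)) (at t within {0..T})"
    proof (rule oscillators_solution_exists[of T "\<epsilon> * L" "\<epsilon> * B" R K \<omega> "\<lambda>k. y0 k / \<epsilon>\<^sup>2 - P k 0"
          "\<lambda>k. (v0 k - \<epsilon> * \<delta> k * w) / \<epsilon>\<^sup>2 - w * P' k 0" "\<lambda>k t x v. \<epsilon> * G k t x v"])
      show "0 \<le> T" "0 \<le> \<epsilon> * L" "T * (\<epsilon> * L) < 1" "0 \<le> \<epsilon> * B" "T * (\<epsilon> * B) \<le> R"
        unfolding T(2) using T(1) \<gamma> \<epsilon> L0 B0 R00 by (auto simp: R_def)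
      show "\<omega> k > 0" if "k \<in> K" for k using that \<omega> by (simp add: K_def)
      show "\<bar>y0 k / \<epsilon>\<^sup>2 - P k 0\<bar> + \<bar>(v0 k - \<epsilon> * \<delta> k * w) / \<epsilon>\<^sup>2 - w * P' k 0\<bar> / \<omega> k + T * (\<epsilon> * B) \<le> R" if k: "k \<in> K" for k
      proof -
        have "\<bar>y0 k / \<epsilon>\<^sup>2\<bar> \<le> C0" using y0[of k] k \<epsilon> by (simp add: K_def field_simps)
        then have 1: "\<bar>y0 k / \<epsilon>\<^sup>2 - P k 0\<bar> \<le> C0 + Cm" using P_le(1)[OF k, of 0] by linarith
        have "\<bar>(v0 k - \<epsilon> * \<omega> 1 * \<delta> k) / \<epsilon>\<^sup>2\<bar> \<le> C0" using v0[of k] k \<epsilon> by (simp add: K_def field_simps)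
        moreover have "\<bar>\<delta> k * \<sigma>\<bar> \<le> \<bar>a\<bar> * \<bar>\<sigma>\<bar>" by (simp add: \<delta>_def abs_mult)
        moreover have "\<bar>w * P' k 0\<bar> \<le> W * Cm" unfolding abs_mult using w_le P_le[OF k] by (intro mult_mono) auto
        moreover have "(v0 k - \<epsilon> * \<delta> k * w) / \<epsilon>\<^sup>2 = (v0 k - \<epsilon> * \<omega> 1 * \<delta> k) / \<epsilon>\<^sup>2 - \<delta> k * \<sigma>"
          using \<epsilon> by (simp add: w field_simps power2_eq_square)
        ultimately have "\<bar>(v0 k - \<epsilon> * \<delta> k * w) / \<epsilon>\<^sup>2 - w * P' k 0\<bar> \<le> C0 + \<bar>a\<bar> * \<bar>\<sigma>\<bar> + W * Cm" by linarith
        then have "\<bar>(v0 k - \<epsilon> * \<delta> k * w) / \<epsilon>\<^sup>2 - w * P' k 0\<bar> / \<omega> k \<le> (C0 + \<bar>a\<bar> * \<bar>\<sigma>\<bar> + W * Cm) / \<omega> k"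
          using \<omega>[of k] k by (intro divide_right_mono) (auto simp: K_def)
        then show ?thesis using 1 R0[OF k] \<gamma>(2) unfolding T(2) R_def by linarith
      qed
      show "\<bar>\<epsilon> * G k t x v\<bar> \<le> \<omega> k * (\<epsilon> * B)" if "k \<in> K" "\<And>i. i \<in> K \<Longrightarrow> \<bar>x i\<bar> \<le> R" "\<And>i. i \<in> K \<Longrightarrow> \<bar>v i\<bar> \<le> \<omega> i * R" for k t x v
        using mult_left_mono[OF G_le[OF that, where t = t], where c = \<epsilon>] \<epsilon> by (simp add: abs_mult mult_ac)
      show "\<bar>\<epsilon> * G k t x v - \<epsilon> * G k t x' v'\<bar> \<le> \<omega> k * (\<epsilon> * L * \<eta>)"
        if "k \<in> K" "\<And>i. i \<in> K \<Longrightarrow> \<bar>x i\<bar> \<le> R" "\<And>i. i \<in> K \<Longrightarrow> \<bar>x' i\<bar> \<le> R"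
        "\<And>i. i \<in> K \<Longrightarrow> \<bar>x i - x' i\<bar> \<le> \<eta>" "\<And>i. i \<in> K \<Longrightarrow> \<bar>v i - v' i\<bar> \<le> \<omega> i * \<eta>" for k t x v x' v' \<eta>
        using mult_left_mono[OF G_lip[OF that, where t = t], where c = \<epsilon>] \<epsilon> by (simp add: abs_mult right_diff_distrib[symmetric] mult_ac)
      show "continuous_on {0..T} (\<lambda>t. \<epsilon> * G k t (\<lambda>i. x i t) (\<lambda>i. v i t))"
        if "k \<in> K" "\<And>i. i \<in> K \<Longrightarrow> continuous_on {0..T} (x i)" "\<And>i. i \<in> K \<Longrightarrow> continuous_on {0..T} (v i)" for k and x v
        using that by (intro continuous_intros G_cont)
    qed blast
    define G' where "G' k t = G k t (\<lambda>i. x i t) (\<lambda>i. v i t)" for k t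
    define r where "r k t = P k (w * t) + x k t" for k t
    define r' where "r' k t = w * P' k (w * t) + v k t" for k t
    define r'' where "r'' k t = w\<^sup>2 * P'' k (w * t) + (- (\<omega> k)\<^sup>2 * x k t + \<epsilon> * G' k t)" for k t
    have dP: "((\<lambda>t. P k (w * t)) has_real_derivative w * P' k (w * t)) (at t within S)"
      "((\<lambda>t. P' k (w * t)) has_real_derivative w * P'' k (w * t)) (at t within S)" if "k \<in> K" for k t S
    proof -
      have "((\<lambda>t. w * t) has_real_derivative w) (at t within S)" by (auto intro!: derivative_eq_intros)
      moreover have "(P k has_real_derivative P' k (w * t)) (at (w * t))" "(P' k has_real_derivative P'' k (w * t)) (at (w * t))"
        using corr[OF that] by auto
      ultimately show "((\<lambda>t. P k (w * t)) has_real_derivative w * P' k (w * t)) (at t within S)"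
        "((\<lambda>t. P' k (w * t)) has_real_derivative w * P'' k (w * t)) (at t within S)"
        using DERIV_chain2 by (metis mult.commute)+
    qed
    have dr: "(r k has_real_derivative r' k t) (at t within {0..T})" "(r' k has_real_derivative r'' k t) (at t within {0..T})"
      if "k \<in> K" "t \<in> {0..T}" for k t
      unfolding r_def[abs_def] r'_def[abs_def] r''_def G'_def
      by (rule dP dx dv derivative_eq_intros that refl | simp add: power2_eq_square)+
    have sum: "(\<Sum>i\<in>K. (\<epsilon> * \<delta> i * sin (w * t) + \<epsilon>\<^sup>2 * r i t) * h i) = \<epsilon> * (m * sin (w * t) + \<epsilon> * Q t (\<lambda>i. x i t))" for t
    proof -
      have "(\<Sum>i\<in>K. \<delta> i * h i) = (\<Sum>i\<in>K. if i = 1 then a * h 1 else 0)" by (intro sum.cong) (auto simp: \<delta>_def)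
      also have "\<dots> = m" using K by (simp add: m_def)
      finally have "m = (\<Sum>i\<in>K. \<delta> i * h i)" by simp
      then show ?thesis
        by (simp add: Q_def r_def sum_distrib_left sum_distrib_right sum.distrib[symmetric] power2_eq_square)
          (intro sum.cong refl, simp add: algebra_simps)
    qed
    have "forced_solution_on T n c d h \<omega> lam f w \<epsilon> y0 v0 (\<lambda>k t. \<epsilon> * \<delta> k * sin (w * t) + \<epsilon>\<^sup>2 * r k t)"
      unfolding forced_solution_on_def K_def[symmetric]
    proof (intro exI ballI conjI)
      fix k assume k: "k \<in> K"
      show "\<epsilon> * \<delta> k * sin (w * 0) + \<epsilon>\<^sup>2 * r k 0 = y0 k" using x0[OF k] \<epsilon> by (simp add: r_def)
      show "\<epsilon> * \<delta> k * w * cos (w * 0) + \<epsilon>\<^sup>2 * r' k 0 = v0 k" using vv0[OF k] \<epsilon> by (simp add: r'_def)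
      fix t assume t: "t \<in> {0..T}"
      show "((\<lambda>t. \<epsilon> * \<delta> k * sin (w * t) + \<epsilon>\<^sup>2 * r k t) has_real_derivative \<epsilon> * \<delta> k * w * cos (w * t) + \<epsilon>\<^sup>2 * r' k t) (at t within {0..T})"
        by (rule derivative_eq_intros dr[OF k t] refl | simp)+
      show "((\<lambda>t. \<epsilon> * \<delta> k * w * cos (w * t) + \<epsilon>\<^sup>2 * r' k t) has_real_derivative - (\<epsilon> * \<delta> k * w\<^sup>2 * sin (w * t)) + \<epsilon>\<^sup>2 * r'' k t) (at t within {0..T})"
        by (rule derivative_eq_intros dr[OF k t] refl | simp add: power2_eq_square)+
      show "- (\<epsilon> * \<delta> k * w\<^sup>2 * sin (w * t)) + \<epsilon>\<^sup>2 * r'' k t + \<epsilon> * lam k * (\<epsilon> * \<delta> k * w * cos (w * t) + \<epsilon>\<^sup>2 * r' k t)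
        + (\<omega> k)\<^sup>2 * (\<epsilon> * \<delta> k * sin (w * t) + \<epsilon>\<^sup>2 * r k t)
        + h k * (c * (\<Sum>i\<in>K. (\<epsilon> * \<delta> i * sin (w * t) + \<epsilon>\<^sup>2 * r i t) * h i)\<^sup>2
          + d / \<epsilon> * (\<Sum>i\<in>K. (\<epsilon> * \<delta> i * sin (w * t) + \<epsilon>\<^sup>2 * r i t) * h i) ^ 3) = \<epsilon>\<^sup>2 * f k * cos (w * t)"
        unfolding sum unfolding r_def r'_def r''_def
      proof (rule modal_residual)
        show "(\<omega> 1)\<^sup>2 * P'' k (w * t) + (\<omega> k)\<^sup>2 * P k (w * t) = (f k - \<delta> k * lam k * \<omega> 1) * cos (w * t) + (2 * \<omega> 1 * \<sigma> * \<delta> k) * sin (w * t)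
          - (h k * c * m\<^sup>2 * sin (w * t) ^ 2 + h k * d * m ^ 3 * sin (w * t) ^ 3)"
          using corr[OF k] by blast
        show "\<delta> k = 0 \<or> \<omega> k = \<omega> 1" by (simp add: \<delta>_def)
        show "w = \<omega> 1 + \<epsilon> * \<sigma>" by (rule w)
        show "\<epsilon> \<noteq> 0" using \<epsilon> by simp
      qed (simp add: G'_def G_def N_def)
    qed
    moreover have "continuous_on {0..T} (r'' k)" if k: "k \<in> K" for k
      unfolding r''_def[abs_def] G'_def
      using DERIV_continuous_on[OF dx] DERIV_continuous_on[OF dv] k
      by (intro continuous_intros contP G_cont) auto
    moreover have "\<bar>r k t\<bar> \<le> C \<and> \<bar>r' k t\<bar> \<le> C \<and> \<bar>r'' k t\<bar> \<le> C" if k: "k \<in> K" and t: "t \<in> {0..T}" for k t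
    proof -
      have pos: "0 < \<omega> k" using \<omega> k by (simp add: K_def)
      have R: "0 \<le> R" and W: "0 \<le> W" using R00 \<omega>1 by (auto simp: R_def W_def)
      have 1: "\<bar>r k t\<bar> \<le> Cm + R"
        unfolding r_def using P_le(1)[OF k] x_le[OF k t] by (meson abs_triangle_ineq add_mono order_trans)
      have "\<bar>w * P' k (w * t)\<bar> \<le> W * Cm" unfolding abs_mult using w_le P_le[OF k] by (intro mult_mono) auto
      then have 2: "\<bar>r' k t\<bar> \<le> W * Cm + \<omega> k * R"
        unfolding r'_def using v_le[OF k t] by (meson abs_triangle_ineq add_mono order_trans)
      have "w\<^sup>2 \<le> W\<^sup>2" using w_le W by (simp add: abs_le_square_iff[symmetric])
      then have "\<bar>w\<^sup>2 * P'' k (w * t)\<bar> \<le> W\<^sup>2 * Cm" unfolding abs_mult using P_le[OF k] by (intro mult_mono) auto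
      moreover have "\<bar>- (\<omega> k)\<^sup>2 * x k t\<bar> \<le> (\<omega> k)\<^sup>2 * R"
        using mult_left_mono[OF x_le[OF k t], of "(\<omega> k)\<^sup>2"] by (simp add: abs_mult)
      moreover have "\<bar>\<epsilon> * G' k t\<bar> \<le> 1 * (\<omega> k * B)"
        unfolding abs_mult G'_def using \<epsilon> x_le v_le t by (intro mult_mono G_le k) auto
      ultimately have 3: "\<bar>r'' k t\<bar> \<le> W\<^sup>2 * Cm + (\<omega> k)\<^sup>2 * R + \<omega> k * B"
        unfolding r''_def by linarith
      have "0 \<le> Cm + R" "0 \<le> W * Cm + \<omega> k * R" "0 \<le> W\<^sup>2 * Cm + (\<omega> k)\<^sup>2 * R + \<omega> k * B"
        using Cm0 R W pos B0 by auto
      then show ?thesis using 1 2 3 C[OF k] by linarith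
    qed
    ultimately show "\<exists>r r' r''. forced_solution_on (\<gamma> / \<epsilon>) n c d h \<omega> lam f (\<Omega> \<epsilon>) \<epsilon> y0 v0
          (\<lambda>k t. \<epsilon> * \<delta> k * sin (\<Omega> \<epsilon> * t) + \<epsilon>\<^sup>2 * r k t) \<and>
        (\<forall>k\<in>{1..n}. continuous_on {0..\<gamma> / \<epsilon>} (r'' k) \<and> (\<forall>t\<in>{0..\<gamma> / \<epsilon>}.
          (r k has_real_derivative r' k t) (at t within {0..\<gamma> / \<epsilon>}) \<and>
          (r' k has_real_derivative r'' k t) (at t within {0..\<gamma> / \<epsilon>}) \<and>
          \<bar>r k t\<bar> \<le> C \<and> \<bar>r' k t\<bar> \<le> C \<and> \<bar>r'' k t\<bar> \<le> C))"
      unfolding w_def[symmetric] T_def[symmetric] K_def[symmetric] using dr by blast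
  qed
qed

section \<open>Stationary solutions, maximal amplitude and frequency\<close>

text \<open>Uniqueness of derivatives forces the derivatives of the constant amplitude and phase to
  be 0, and one instant then yields the algebraic equations.\<close>

lemma stationary_solution_iff:
  "stationary_solution w l f dt \<sigma> a \<beta> \<longleftrightarrow>
    a > 0 \<and> l * a * w + f * sin \<beta> = 0 \<and> 2 * a * w * \<sigma> - 3 * dt * a ^ 3 / 4 + f * cos \<beta> = 0"
proof
  assume st: "stationary_solution w l f dt \<sigma> a \<beta>"
  then obtain A' B' where AB: "\<And>T. ((\<lambda>_. a) has_real_derivative A' T) (at T)"
    "\<And>T. ((\<lambda>_. \<beta>) has_real_derivative B' T) (at T)"
    and eqs: "\<And>T. w * (2 * A' T + l * a) = - f * sin \<beta>"
    "\<And>T. 2 * w * (a * B' T + \<sigma> * a) = 3 * dt * a ^ 3 / 4 - f * cos \<beta>"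
    unfolding stationary_solution_def modulation_solution_def by blast
  have "A' 0 = 0" "B' 0 = 0" using DERIV_unique[OF AB(1)] DERIV_unique[OF AB(2)] DERIV_const by blast+
  then show "a > 0 \<and> l * a * w + f * sin \<beta> = 0 \<and> 2 * a * w * \<sigma> - 3 * dt * a ^ 3 / 4 + f * cos \<beta> = 0"
    using eqs[of 0] st by (simp add: stationary_solution_def algebra_simps)
next
  assume "a > 0 \<and> l * a * w + f * sin \<beta> = 0 \<and> 2 * a * w * \<sigma> - 3 * dt * a ^ 3 / 4 + f * cos \<beta> = 0"
  then show "stationary_solution w l f dt \<sigma> a \<beta>"
    unfolding stationary_solution_def modulation_solution_def
    by (intro conjI exI[of _ "\<lambda>_. 0"]) (auto simp: algebra_simps)
qed

text \<open>The first stationary equation reads l w a = - f sin \<beta>, so that a is at most f / (l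
  w), with equality exactly for sin \<beta> = -1. Then cos \<beta> = 0, and the second equation
  determines \<sigma>.\<close>

lemma max_amplitude_solution_iff:
  assumes w: "w > 0" and l: "l > 0" and f: "f > 0"
  shows "max_amplitude_solution w l f dt \<sigma> a \<beta> \<longleftrightarrow>
    f = l * w * a \<and> sin \<beta> = - 1 \<and> \<sigma> = 3 * dt * a\<^sup>2 / (8 * w)"
proof -
  define b where "b = f / (l * w)"
  have b: "b > 0" "f = l * w * b" using assms by (auto simp: b_def)
  have le: "a' \<le> b" if "stationary_solution w l f dt \<sigma>' a' \<beta>'" for \<sigma>' a' \<beta>'
  proof -
    have "l * a' * w = f * (- sin \<beta>')" using that by (simp add: stationary_solution_iff)
    also have "\<dots> \<le> f * 1" using f sin_ge_minus_one[of \<beta>'] by (intro mult_left_mono) auto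
    finally show ?thesis using w l by (simp add: b_def field_simps)
  qed
  have detuning: "2 * b * w * \<sigma>' - 3 * dt * b ^ 3 / 4 = 0 \<longleftrightarrow> \<sigma>' = 3 * dt * b\<^sup>2 / (8 * w)" for \<sigma>'
    using b(1) w by (auto simp: field_simps power2_eq_square power3_eq_cube)
  have cos0: "cos \<beta>' = 0" if "sin \<beta>' = - 1" for \<beta>' :: real
    using sin_cos_squared_add[of \<beta>'] that by simp
  have stat: "stationary_solution w l f dt \<sigma>' b \<beta>' \<longleftrightarrow> sin \<beta>' = - 1 \<and> \<sigma>' = 3 * dt * b\<^sup>2 / (8 * w)" for \<sigma>' \<beta>'
  proof -
    have "l * b * w + f * sin \<beta>' = 0 \<longleftrightarrow> sin \<beta>' = - 1"
    proof -
      have "l * b * w + f * sin \<beta>' = f * (sin \<beta>' + 1)" using b(2) by (simp add: algebra_simps)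
      then show ?thesis using f by auto
    qed
    then show ?thesis unfolding stationary_solution_iff using b(1) cos0[of \<beta>'] detuning[of \<sigma>'] by auto
  qed
  \<comment> \<open>The bound \<open>b\<close> is attained, at phase -\<pi>/2; hence every maximal
    solution has amplitude exactly \<open>b\<close>.\<close>
  have ex: "stationary_solution w l f dt (3 * dt * b\<^sup>2 / (8 * w)) b (- (pi / 2))"
    by (simp add: stat)
  have "max_amplitude_solution w l f dt \<sigma> a \<beta> \<longleftrightarrow> a = b \<and> stationary_solution w l f dt \<sigma> a \<beta>"
    unfolding max_amplitude_solution_def using le ex by (metis order_antisym)
  also have "\<dots> \<longleftrightarrow> a = b \<and> sin \<beta> = - 1 \<and> \<sigma> = 3 * dt * a\<^sup>2 / (8 * w)"
    using stat by auto
  also have "a = b \<longleftrightarrow> f = l * w * a"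
    using w l by (auto simp: b_def field_simps)
  finally show ?thesis .
qed

lemma has_angular_freq_cos:
  assumes "c \<noteq> 0" and \<Omega>: "\<Omega> > 0"
  shows "has_angular_freq (\<lambda>t. c * cos (\<Omega> * t + \<psi>)) \<Omega>"
  unfolding has_angular_freq_def
proof (intro conjI allI impI)
  show "0 < \<Omega>" by (rule \<Omega>)
  show "c * cos (\<Omega> * (t + 2 * pi / \<Omega>) + \<psi>) = c * cos (\<Omega> * t + \<psi>)" for t
  proof -
    have "\<Omega> * (t + 2 * pi / \<Omega>) + \<psi> = (\<Omega> * t + \<psi>) + 2 * pi" using \<Omega> by (simp add: field_simps)
    then show ?thesis by (simp only: cos_periodic)
  qed
  fix T assume T: "0 < T \<and> T < 2 * pi / \<Omega>"
  \<comment> \<open>A shift by \<open>T\<close> is tested where the phase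
    \<open>\<Omega> * t + \<psi>\<close> is 0 and the cosine is 1. Invariance there would put an
    integer strictly between 0 and 1.\<close>
  have "cos (\<Omega> * T) \<noteq> 1"
  proof
    assume "cos (\<Omega> * T) = 1"
    then obtain i :: int where i: "\<Omega> * T = of_int i * 2 * pi" by (auto simp: cos_one_2pi_int)
    have "0 < \<Omega> * T" "\<Omega> * T < 2 * pi" using T \<Omega> by (auto simp: field_simps)
    then have "0 < of_int i * (2 * pi)" "of_int i * (2 * pi) < 1 * (2 * pi)"
      unfolding i by (simp_all add: mult.assoc)
    then have "0 < (of_int i :: real)" "(of_int i :: real) < 1" by (auto simp: zero_less_mult_iff)
    then show False by simp
  qed
  then show "\<exists>t. c * cos (\<Omega> * (t + T) + \<psi>) \<noteq> c * cos (\<Omega> * t + \<psi>)"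
    using assms by (intro exI[of _ "- \<psi> / \<Omega>"]) (simp add: field_simps)
qed

section \<open>Response to the initial data of the maximal solution\<close>

text \<open>At the phase of the maximal solution the prescribed data of mode 1 are position 0 and
  velocity \<epsilon> w a. Since there are finitely many modes, their asymptotic bounds can share
  one constant and one range of \<epsilon>.\<close>

lemma stationary_initial_dataD:
  assumes "stationary_initial_data n w a \<beta> y0 v0" and "sin \<beta> = - 1" "cos \<beta> = 0"
  obtains C where "\<forall>\<^sub>F \<epsilon> in at_right 0. \<forall>k\<in>{1..n}. \<bar>y0 \<epsilon> k\<bar> \<le> C * \<epsilon>\<^sup>2 \<and>
    \<bar>v0 \<epsilon> k - \<epsilon> * w * (if k = 1 then a else 0)\<bar> \<le> C * \<epsilon>\<^sup>2"
proof -
  define e where "e k \<epsilon> = \<bar>y0 \<epsilon> k\<bar> + \<bar>v0 \<epsilon> k - \<epsilon> * w * (if k = 1 then a else 0)\<bar>" for k \<epsilon>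
  have pos: "\<forall>\<^sub>F \<epsilon> in at_right 0. (\<epsilon>::real) > 0" by (rule eventually_at_right_less)
  have big: "e k \<in> O[at_right 0](\<lambda>\<epsilon>. \<epsilon>\<^sup>2)" if k: "k \<in> {1..n}" for k
  proof (cases "k = 1")
    case True
    then show ?thesis
      using assms unfolding e_def[abs_def] stationary_initial_data_def by (auto intro!: sum_in_bigo)
  next
    case False
    then have "k \<in> {2..n}" using k by auto
    then have y: "(\<lambda>\<epsilon>. y0 \<epsilon> k) \<in> O[at_right 0](\<lambda>\<epsilon>. \<epsilon>\<^sup>2)" and v: "\<forall>\<epsilon>>0. v0 \<epsilon> k = 0"
      using assms(1) by (auto simp: stationary_initial_data_def)
    \<comment> \<open>The velocities of these modes vanish only for positive \<epsilon>, so the two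
      functions are compared eventually.\<close>
    have eq: "\<forall>\<^sub>F \<epsilon> in at_right 0. \<bar>y0 \<epsilon> k\<bar> = e k \<epsilon>"
      using pos by eventually_elim (use v False in \<open>simp add: e_def\<close>)
    have "(\<lambda>\<epsilon>. \<bar>y0 \<epsilon> k\<bar>) \<in> O[at_right 0](\<lambda>\<epsilon>. \<epsilon>\<^sup>2)" using y by simp
    then show ?thesis unfolding landau_o.big.in_cong[OF eq] .
  qed
  have "\<exists>c. \<forall>\<^sub>F \<epsilon> in at_right 0. norm (e k \<epsilon>) \<le> c * norm (\<epsilon>\<^sup>2)" if "k \<in> {1..n}" for k
    using big[OF that] by (rule landau_o.bigE) blast
  then obtain c where c: "\<And>k. k \<in> {1..n} \<Longrightarrow> \<forall>\<^sub>F \<epsilon> in at_right 0. norm (e k \<epsilon>) \<le> c k * norm (\<epsilon>\<^sup>2)"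
    by metis
  obtain C where C: "\<And>k. k \<in> {1..n} \<Longrightarrow> c k \<le> C"
    using finite_family_bound[of "{1..n}" c] by auto
  have "\<forall>\<^sub>F \<epsilon> in at_right 0. \<forall>k\<in>{1..n}. norm (e k \<epsilon>) \<le> c k * norm (\<epsilon>\<^sup>2)"
    by (rule eventually_ball_finite) (use c in auto)
  then have "\<forall>\<^sub>F \<epsilon> in at_right 0. \<forall>k\<in>{1..n}. \<bar>y0 \<epsilon> k\<bar> \<le> C * \<epsilon>\<^sup>2 \<and>
    \<bar>v0 \<epsilon> k - \<epsilon> * w * (if k = 1 then a else 0)\<bar> \<le> C * \<epsilon>\<^sup>2"
  proof eventually_elim
    case (elim \<epsilon>)
    show ?case
    proof
      fix k assume k: "k \<in> {1..n}"
      have "e k \<epsilon> \<le> c k * \<epsilon>\<^sup>2" using elim k by (force simp: abs_le_iff)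
      also have "\<dots> \<le> C * \<epsilon>\<^sup>2" using C[OF k] by (intro mult_right_mono) auto
      finally show "\<bar>y0 \<epsilon> k\<bar> \<le> C * \<epsilon>\<^sup>2 \<and> \<bar>v0 \<epsilon> k - \<epsilon> * w * (if k = 1 then a else 0)\<bar> \<le> C * \<epsilon>\<^sup>2"
        unfolding e_def by linarith
    qed
  qed
  then show ?thesis by (rule that)
qed

text \<open>The constants are chosen in the order \<open>C0\<close>, then \<open>\<gamma>\<close>
  and \<open>C\<close>: the time scale may depend on the family of initial data, but not on
  \<epsilon>.\<close>

lemma forced_response:
  fixes n :: nat and c d a \<beta> \<sigma> :: real and h \<omega> lam f :: "nat \<Rightarrow> real"
  assumes n: "n \<ge> 1" and \<omega>: "\<And>k. k \<in> {1..n} \<Longrightarrow> \<omega> k > 0"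
    and indep: "\<And>k. k \<in> {2..n} \<Longrightarrow> int_independent (\<omega> k) (\<omega> 1)"
    and amp: "f 1 = lam 1 * \<omega> 1 * a" and lam: "lam 1 > 0"
    and det: "\<sigma> = 3 * (d * h 1 ^ 4) * a\<^sup>2 / (8 * \<omega> 1)"
    and phase: "sin \<beta> = - 1" "cos \<beta> = 0"
    and init: "stationary_initial_data n (\<omega> 1) a \<beta> y0 v0"
  shows "\<exists>\<gamma>>0. \<exists>y r :: nat \<Rightarrow> real \<Rightarrow> real \<Rightarrow> real.
             (\<forall>\<^sub>F \<epsilon> in at_right 0.
                forced_solution_on (\<gamma>/\<epsilon>) n c d h \<omega> lam f (excitation_freq (\<omega> 1) \<sigma> \<epsilon>) \<epsilon>
                  (y0 \<epsilon>) (v0 \<epsilon>) (\<lambda>k. y k \<epsilon>)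
              \<and> (\<forall>z. forced_solution_on (\<gamma>/\<epsilon>) n c d h \<omega> lam f (excitation_freq (\<omega> 1) \<sigma> \<epsilon>) \<epsilon>
                       (y0 \<epsilon>) (v0 \<epsilon>) z \<longrightarrow> (\<forall>k\<in>{1..n}. \<forall>t\<in>{0..\<gamma>/\<epsilon>}. z k t = y k \<epsilon> t))
              \<and> (\<forall>t\<in>{0..\<gamma>/\<epsilon>}.
                   y 1 \<epsilon> t = \<epsilon> * (f 1 / (lam 1 * \<omega> 1)) * sin (excitation_freq (\<omega> 1) \<sigma> \<epsilon> * t)
                           + \<epsilon>^2 * r 1 \<epsilon> t
                 \<and> (\<forall>k\<in>{2..n}. y k \<epsilon> t = \<epsilon>^2 * r k \<epsilon> t)))
           \<and> (\<forall>k\<in>{1..n}. uniformly_bounded_C2 \<gamma> (r k))"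
proof -
  have \<omega>1: "\<omega> 1 > 0" using \<omega> n by simp
  have nonres: "\<omega> k \<noteq> 2 * \<omega> 1 \<and> \<omega> k \<noteq> 3 * \<omega> 1 \<and> (k \<noteq> 1 \<longrightarrow> \<omega> k \<noteq> \<omega> 1)" if k: "k \<in> {1..n}" for k
  proof (cases "k = 1")
    case False
    then have ind: "int_independent (\<omega> k) (\<omega> 1)" using k by (intro indep) auto
    \<comment> \<open>Independence, applied to the coefficients 1 and -q, excludes every integer
      multiple; the multiples 1, 2 and 3 are those that the corrector must avoid.\<close>
    have "\<omega> k \<noteq> of_int q * \<omega> 1" for q :: int
    proof
      assume "\<omega> k = of_int q * \<omega> 1"
      then have "of_int 1 * \<omega> k + of_int (- q) * \<omega> 1 = 0" by simp
      then show False using ind unfolding int_independent_def by (metis zero_neq_one)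
    qed
    from this[of 1] this[of 2] this[of 3] show ?thesis by simp
  qed (use \<omega>1 in simp)
  obtain C0 where C0: "\<forall>\<^sub>F \<epsilon> in at_right 0. \<forall>k\<in>{1..n}. \<bar>y0 \<epsilon> k\<bar> \<le> C0 * \<epsilon>\<^sup>2 \<and>
    \<bar>v0 \<epsilon> k - \<epsilon> * \<omega> 1 * (if k = 1 then a else 0)\<bar> \<le> C0 * \<epsilon>\<^sup>2"
    by (rule stationary_initial_dataD[OF init phase])
  obtain \<gamma> C where \<gamma>: "\<gamma> > 0" and sol: "\<And>\<epsilon> y0 v0. 0 < \<epsilon> \<Longrightarrow> \<epsilon> \<le> 1 \<Longrightarrow> (\<And>k. k \<in> {1..n} \<Longrightarrow> \<bar>y0 k\<bar> \<le> C0 * \<epsilon>\<^sup>2) \<Longrightarrow>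
      (\<And>k. k \<in> {1..n} \<Longrightarrow> \<bar>v0 k - \<epsilon> * \<omega> 1 * (if k = 1 then a else 0)\<bar> \<le> C0 * \<epsilon>\<^sup>2) \<Longrightarrow>
      \<exists>r r' r''. forced_solution_on (\<gamma> / \<epsilon>) n c d h \<omega> lam f (excitation_freq (\<omega> 1) \<sigma> \<epsilon>) \<epsilon> y0 v0
          (\<lambda>k t. \<epsilon> * (if k = 1 then a else 0) * sin (excitation_freq (\<omega> 1) \<sigma> \<epsilon> * t) + \<epsilon>\<^sup>2 * r k t) \<and>
        (\<forall>k\<in>{1..n}. continuous_on {0..\<gamma> / \<epsilon>} (r'' k) \<and> (\<forall>t\<in>{0..\<gamma> / \<epsilon>}.
          (r k has_real_derivative r' k t) (at t within {0..\<gamma> / \<epsilon>}) \<and>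
          (r' k has_real_derivative r'' k t) (at t within {0..\<gamma> / \<epsilon>}) \<and>
          \<bar>r k t\<bar> \<le> C \<and> \<bar>r' k t\<bar> \<le> C \<and> \<bar>r'' k t\<bar> \<le> C))"
    using near_resonant_solution[where n = n and \<omega> = \<omega> and lam = lam and f = f and d = d and h = h and c = c
        and ?C0.0 = C0, OF n \<omega> nonres amp det] by blast
  define S where "S \<epsilon> r \<longleftrightarrow> forced_solution_on (\<gamma> / \<epsilon>) n c d h \<omega> lam f (excitation_freq (\<omega> 1) \<sigma> \<epsilon>) \<epsilon> (y0 \<epsilon>) (v0 \<epsilon>)
      (\<lambda>k t. \<epsilon> * (if k = 1 then a else 0) * sin (excitation_freq (\<omega> 1) \<sigma> \<epsilon> * t) + \<epsilon>\<^sup>2 * r k t)" for \<epsilon> r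
  define D where "D \<epsilon> r \<longleftrightarrow> (\<exists>r' r''. \<forall>k\<in>{1..n}. continuous_on {0..\<gamma> / \<epsilon>} (r'' k) \<and> (\<forall>t\<in>{0..\<gamma> / \<epsilon>}.
          (r k has_real_derivative r' k t) (at t within {0..\<gamma> / \<epsilon>}) \<and>
          (r' k has_real_derivative r'' k t) (at t within {0..\<gamma> / \<epsilon>}) \<and>
          \<bar>r k t\<bar> \<le> C \<and> \<bar>r' k t\<bar> \<le> C \<and> \<bar>r'' k t\<bar> \<le> C))" for \<epsilon> and r :: "nat \<Rightarrow> real \<Rightarrow> real"
  \<comment> \<open>A remainder exists separately for each small \<epsilon>; choice turns these into
    one family having both the solution property \<open>S\<close> and the regularity
    \<open>D\<close>.\<close>
  define R where "R \<epsilon> = (SOME r. S \<epsilon> r \<and> D \<epsilon> r)" for \<epsilon>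
  have "\<forall>\<^sub>F \<epsilon> in at_right 0. 0 < \<epsilon> \<and> \<epsilon> \<le> (1::real)"
    unfolding eventually_at_right_field by (intro exI[of _ 1]) auto
  with C0 have SD: "\<forall>\<^sub>F \<epsilon> in at_right 0. S \<epsilon> (R \<epsilon>) \<and> D \<epsilon> (R \<epsilon>)"
  proof eventually_elim
    case (elim \<epsilon>)
    have "\<exists>r. S \<epsilon> r \<and> D \<epsilon> r"
      using sol[of \<epsilon> "y0 \<epsilon>" "v0 \<epsilon>"] elim unfolding S_def D_def by blast
    then show ?case unfolding R_def by (rule someI_ex)
  qed
  define r where "r k \<epsilon> t = R \<epsilon> k t" for k \<epsilon> t
  define y where "y k \<epsilon> t = \<epsilon> * (if k = 1 then a else 0) * sin (excitation_freq (\<omega> 1) \<sigma> \<epsilon> * t) + \<epsilon>\<^sup>2 * r k \<epsilon> t" for k \<epsilon> t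
  have a: "f 1 / (lam 1 * \<omega> 1) = a" using lam \<omega>1 unfolding amp by simp
  have "\<forall>\<^sub>F \<epsilon> in at_right 0.
      forced_solution_on (\<gamma>/\<epsilon>) n c d h \<omega> lam f (excitation_freq (\<omega> 1) \<sigma> \<epsilon>) \<epsilon> (y0 \<epsilon>) (v0 \<epsilon>) (\<lambda>k. y k \<epsilon>)
    \<and> (\<forall>z. forced_solution_on (\<gamma>/\<epsilon>) n c d h \<omega> lam f (excitation_freq (\<omega> 1) \<sigma> \<epsilon>) \<epsilon> (y0 \<epsilon>) (v0 \<epsilon>) z \<longrightarrow>
        (\<forall>k\<in>{1..n}. \<forall>t\<in>{0..\<gamma>/\<epsilon>}. z k t = y k \<epsilon> t))
    \<and> (\<forall>t\<in>{0..\<gamma>/\<epsilon>}. y 1 \<epsilon> t = \<epsilon> * (f 1 / (lam 1 * \<omega> 1)) * sin (excitation_freq (\<omega> 1) \<sigma> \<epsilon> * t) + \<epsilon>^2 * r 1 \<epsilon> t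
       \<and> (\<forall>k\<in>{2..n}. y k \<epsilon> t = \<epsilon>^2 * r k \<epsilon> t))"
    using SD
  proof eventually_elim
    case (elim \<epsilon>)
    then have fs: "forced_solution_on (\<gamma>/\<epsilon>) n c d h \<omega> lam f (excitation_freq (\<omega> 1) \<sigma> \<epsilon>) \<epsilon> (y0 \<epsilon>) (v0 \<epsilon>) (\<lambda>k. y k \<epsilon>)"
      unfolding S_def y_def r_def by blast
    show ?case using fs forced_solution_unique[OF fs] unfolding a by (auto simp: y_def)
  qed
  moreover have "uniformly_bounded_C2 \<gamma> (r k)" if k: "k \<in> {1..n}" for k
    unfolding uniformly_bounded_C2_def
  proof (rule exI[of _ C], use SD in eventually_elim)
    case (elim \<epsilon>)
    then obtain r' r'' where D: "continuous_on {0..\<gamma> / \<epsilon>} (r'' k)" "\<And>t. t \<in> {0..\<gamma> / \<epsilon>} \<Longrightarrow>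
          (R \<epsilon> k has_real_derivative r' k t) (at t within {0..\<gamma> / \<epsilon>}) \<and>
          (r' k has_real_derivative r'' k t) (at t within {0..\<gamma> / \<epsilon>}) \<and>
          \<bar>R \<epsilon> k t\<bar> \<le> C \<and> \<bar>r' k t\<bar> \<le> C \<and> \<bar>r'' k t\<bar> \<le> C"
      unfolding D_def using k by blast
    \<comment> \<open>In the open interval the derivatives relative to the closed interval are
      two-sided.\<close>
    have at: "at t within {0..\<gamma> / \<epsilon>} = at t" if "t \<in> {0<..<\<gamma> / \<epsilon>}" for t
      using that by (intro at_within_Icc_at) auto
    show ?case
      unfolding r_def[abs_def]
    proof (rule exI[of _ "r' k"], rule exI[of _ "r'' k"], intro conjI ballI)
      show "continuous_on {0<..<\<gamma> / \<epsilon>} (r'' k)" using D(1) by (rule continuous_on_subset) auto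
      fix t assume t: "t \<in> {0<..<\<gamma> / \<epsilon>}"
      then have "t \<in> {0..\<gamma> / \<epsilon>}" by auto
      from D(2)[OF this] show "((\<lambda>t. R \<epsilon> k t) has_real_derivative r' k t) (at t)" "(r' k has_real_derivative r'' k t) (at t)"
        "\<bar>R \<epsilon> k t\<bar> \<le> C" "\<bar>r' k t\<bar> \<le> C" "\<bar>r'' k t\<bar> \<le> C"
        unfolding at[OF t] by auto
    qed
  qed
  ultimately show ?thesis using \<gamma> by blast
qed

section \<open>Maximal amplitude at the free frequency, and the resulting response\<close>

theorem proposition3p4:
  fixes n p :: nat and c d :: real
    and M K :: "real Matrix.mat" and \<phi> :: "nat \<Rightarrow> real Matrix.vec"
    and \<omega> lam f :: "nat \<Rightarrow> real"
  defines "h \<equiv> (\<lambda>k. jump p (\<phi> k))"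
  defines "dt \<equiv> d * (jump p (\<phi> 1)) ^ 4"
  assumes "n \<ge> 2" and "p \<in> {2..n}"
    and "sym_pos_def n M" and "sym_pos_def n K"
    and "\<forall>k\<in>{1..n}. \<omega> k > 0 \<and> \<phi> k \<in> carrier_vec n"
    and "\<forall>k\<in>{1..n}. K *\<^sub>v \<phi> k = (\<omega> k)^2 \<cdot>\<^sub>v (M *\<^sub>v \<phi> k)"
    and "\<forall>k\<in>{1..n}. \<forall>l\<in>{1..n}. scalar_prod (\<phi> k) (M *\<^sub>v \<phi> l) = (if k = l then 1 else 0)"
    and "\<forall>k\<in>{2..n}. int_independent (\<omega> k) (\<omega> 1)"
    and "\<forall>k\<in>{1..n}. lam k > 0" and "f 1 > 0"
  shows
    "(\<forall>\<sigma> a \<beta>. stationary_solution (\<omega> 1) (lam 1) (f 1) dt \<sigma> a \<beta> \<longrightarrow>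
        lam 1 * a * \<omega> 1 + f 1 * sin \<beta> = 0 \<and>
        2 * a * \<omega> 1 * \<sigma> - 3 * dt * a^3 / 4 + f 1 * cos \<beta> = 0)
   \<and> (\<exists>\<sigma> a \<beta>. max_amplitude_solution (\<omega> 1) (lam 1) (f 1) dt \<sigma> a \<beta>)
   \<and> (\<forall>\<sigma> a \<beta>. stationary_solution (\<omega> 1) (lam 1) (f 1) dt \<sigma> a \<beta> \<longrightarrow>
        (max_amplitude_solution (\<omega> 1) (lam 1) (f 1) dt \<sigma> a \<beta> \<longleftrightarrow>
          \<sigma> = 3 * dt * a^2 / (8 * \<omega> 1) \<and> (\<exists>k::int. \<beta> = pi / 2 + of_int k * pi)))
   \<and> (\<forall>\<sigma> a \<beta>. max_amplitude_solution (\<omega> 1) (lam 1) (f 1) dt \<sigma> a \<beta> \<longrightarrow>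
        f 1 = lam 1 * \<omega> 1 * a
      \<and> (\<forall>\<epsilon>. excitation_freq (\<omega> 1) \<sigma> \<epsilon> = \<omega> 1 + 3 * \<epsilon> * (dt * a^2 / (8 * \<omega> 1)))
      \<and> (\<forall>\<epsilon>. excitation_freq (\<omega> 1) \<sigma> \<epsilon> = free_freq (\<omega> 1) d (h 1) a \<epsilon>)
      \<and> (\<forall>\<^sub>F \<epsilon> in at_right 0.
           has_angular_freq (free_approx (\<omega> 1) d (h 1) a \<epsilon>) (excitation_freq (\<omega> 1) \<sigma> \<epsilon>)
         \<and> has_angular_freq (stationary_approx (\<omega> 1) \<sigma> a \<beta> \<epsilon>) (excitation_freq (\<omega> 1) \<sigma> \<epsilon>))
      \<and> (\<forall>\<epsilon> t. stationary_approx (\<omega> 1) \<sigma> a \<beta> \<epsilon> t =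
           \<epsilon> * (f 1 / (lam 1 * \<omega> 1)) * sin (excitation_freq (\<omega> 1) \<sigma> \<epsilon> * t))
      \<and> (\<forall>y0 v0. stationary_initial_data n (\<omega> 1) a \<beta> y0 v0 \<longrightarrow>
          (\<exists>\<gamma>>0. \<exists>y r :: nat \<Rightarrow> real \<Rightarrow> real \<Rightarrow> real.
             (\<forall>\<^sub>F \<epsilon> in at_right 0.
                forced_solution_on (\<gamma>/\<epsilon>) n c d h \<omega> lam f (excitation_freq (\<omega> 1) \<sigma> \<epsilon>) \<epsilon>
                  (y0 \<epsilon>) (v0 \<epsilon>) (\<lambda>k. y k \<epsilon>)
              \<and> (\<forall>z. forced_solution_on (\<gamma>/\<epsilon>) n c d h \<omega> lam f (excitation_freq (\<omega> 1) \<sigma> \<epsilon>) \<epsilon>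
                       (y0 \<epsilon>) (v0 \<epsilon>) z \<longrightarrow> (\<forall>k\<in>{1..n}. \<forall>t\<in>{0..\<gamma>/\<epsilon>}. z k t = y k \<epsilon> t))
              \<and> (\<forall>t\<in>{0..\<gamma>/\<epsilon>}.
                   y 1 \<epsilon> t = \<epsilon> * (f 1 / (lam 1 * \<omega> 1)) * sin (excitation_freq (\<omega> 1) \<sigma> \<epsilon> * t)
                           + \<epsilon>^2 * r 1 \<epsilon> t
                 \<and> (\<forall>k\<in>{2..n}. y k \<epsilon> t = \<epsilon>^2 * r k \<epsilon> t)))
           \<and> (\<forall>k\<in>{1..n}. uniformly_bounded_C2 \<gamma> (r k)))))"
proof -
  have n: "1 \<in> {1..n}" using \<open>n \<ge> 2\<close> by simp
  have \<omega>: "\<omega> k > 0" if "k \<in> {1..n}" for k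
    using \<open>\<forall>k\<in>{1..n}. \<omega> k > 0 \<and> \<phi> k \<in> carrier_vec n\<close> that by blast
  have l1: "lam 1 > 0" using \<open>\<forall>k\<in>{1..n}. lam k > 0\<close> n by blast
  note \<omega>1 = \<omega>[OF n]
  note f1 = \<open>f 1 > 0\<close>
  note max_iff = max_amplitude_solution_iff[OF \<omega>1 l1 f1, of dt]
  have cos0: "cos \<beta> = 0" if "sin \<beta> = - 1" for \<beta> :: real
    using sin_cos_squared_add[of \<beta>] that by simp
  have cos0_iff: "cos \<beta> = 0 \<longleftrightarrow> (\<exists>k::int. \<beta> = pi / 2 + of_int k * pi)" for \<beta> :: real
    by (simp add: cos_zero_iff_int2 add.commute)
  have max_ex: "max_amplitude_solution (\<omega> 1) (lam 1) (f 1) dt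
      (3 * dt * (f 1 / (lam 1 * \<omega> 1))\<^sup>2 / (8 * \<omega> 1)) (f 1 / (lam 1 * \<omega> 1)) (- (pi / 2))"
    unfolding max_iff using \<omega>1 l1 by simp
  have max_stationary: "max_amplitude_solution (\<omega> 1) (lam 1) (f 1) dt \<sigma> a \<beta> \<longleftrightarrow>
      \<sigma> = 3 * dt * a\<^sup>2 / (8 * \<omega> 1) \<and> (\<exists>k::int. \<beta> = pi / 2 + of_int k * pi)"
    if st: "stationary_solution (\<omega> 1) (lam 1) (f 1) dt \<sigma> a \<beta>" for \<sigma> a \<beta>
  proof -
    have st': "a > 0" "lam 1 * a * \<omega> 1 = - (f 1 * sin \<beta>)" using st by (auto simp: stationary_solution_iff)
    \<comment> \<open>The condition cos \<beta> = 0 leaves sin \<beta> = 1 or -1. The value 1 would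
      make the positive product \<open>lam 1 * a * \<omega> 1\<close> equal to
      \<open>- f 1\<close>.\<close>
    have "f 1 = lam 1 * \<omega> 1 * a \<and> sin \<beta> = - 1" if "cos \<beta> = 0"
    proof -
      have "(sin \<beta>)\<^sup>2 = 1" using sin_cos_squared_add[of \<beta>] that by simp
      moreover have "sin \<beta> \<noteq> 1"
      proof
        assume "sin \<beta> = 1"
        moreover have "lam 1 * a * \<omega> 1 > 0" by (intro mult_pos_pos st'(1) \<omega>1 l1)
        ultimately show False using st'(2) f1 by simp
      qed
      ultimately have "sin \<beta> = - 1" by (simp add: power2_eq_1_iff)
      then show ?thesis using st'(2) by (simp add: mult_ac)
    qed
    then show ?thesis unfolding max_iff cos0_iff[symmetric] using cos0 by blast
  qed
  have maxD: "f 1 = lam 1 * \<omega> 1 * a" "sin \<beta> = - 1" "\<sigma> = 3 * dt * a\<^sup>2 / (8 * \<omega> 1)"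
    if "max_amplitude_solution (\<omega> 1) (lam 1) (f 1) dt \<sigma> a \<beta>" for \<sigma> a \<beta>
    using that unfolding max_iff by blast+
  have a_eq: "f 1 / (lam 1 * \<omega> 1) = a" if "f 1 = lam 1 * \<omega> 1 * a" for a
    unfolding that using l1 \<omega>1 by simp
  have freq: "excitation_freq (\<omega> 1) \<sigma> \<epsilon> = \<omega> 1 + 3 * \<epsilon> * (dt * a^2 / (8 * \<omega> 1))"
    if "\<sigma> = 3 * dt * a\<^sup>2 / (8 * \<omega> 1)" for \<sigma> a \<epsilon>
    unfolding that excitation_freq_def by simp
  have free: "excitation_freq (\<omega> 1) \<sigma> \<epsilon> = free_freq (\<omega> 1) d (h 1) a \<epsilon>"
    if "\<sigma> = 3 * dt * a\<^sup>2 / (8 * \<omega> 1)" for \<sigma> a \<epsilon>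
    unfolding freq[OF that] free_freq_def dt_def h_def by simp
  show ?thesis
  proof (intro conjI allI impI, goal_cases)
    case (1 \<sigma> a \<beta>)
    then show ?case unfolding stationary_solution_iff by blast
  next
    case (2 \<sigma> a \<beta>)
    then show ?case unfolding stationary_solution_iff by blast
  next
    case 3
    show ?case using max_ex by blast
  next
    case (4 \<sigma> a \<beta>)
    then show ?case by (rule max_stationary)
  next
    case (5 \<sigma> a \<beta>)
    then show ?case by (rule maxD)
  next
    case (6 \<sigma> a \<beta> \<epsilon>)
    show ?case by (rule freq[OF maxD(3)[OF 6]])
  next
    case (7 \<sigma> a \<beta> \<epsilon>)
    show ?case by (rule free[OF maxD(3)[OF 7]])
  next
    case (8 \<sigma> a \<beta>)
    have amp: "f 1 = lam 1 * \<omega> 1 * a" and \<sigma>: "\<sigma> = 3 * dt * a\<^sup>2 / (8 * \<omega> 1)" by (fact maxD[OF 8])+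
    have a: "a \<noteq> 0" using amp f1 by auto
    \<comment> \<open>The detuning may be negative, but the frequency tends to
      \<open>\<omega> 1\<close> and is therefore positive for small \<epsilon>.\<close>
    have "((\<lambda>\<epsilon>. excitation_freq (\<omega> 1) \<sigma> \<epsilon>) \<longlongrightarrow> \<omega> 1) (at_right 0)"
      unfolding excitation_freq_def by (auto intro!: tendsto_eq_intros)
    then have "\<forall>\<^sub>F \<epsilon> in at_right 0. excitation_freq (\<omega> 1) \<sigma> \<epsilon> > 0"
      by (rule order_tendstoD) (rule \<omega>1)
    moreover have "\<forall>\<^sub>F \<epsilon> in at_right 0. (\<epsilon>::real) > 0" by (rule eventually_at_right_less)
    ultimately show ?case
    proof eventually_elim
      case (elim \<epsilon>)
      show ?case
        unfolding free_approx_def[abs_def] stationary_approx_def[abs_def] free[OF \<sigma>, symmetric]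
        using has_angular_freq_cos[of "\<epsilon> * a" "excitation_freq (\<omega> 1) \<sigma> \<epsilon>" 0]
          has_angular_freq_cos[of "\<epsilon> * a" "excitation_freq (\<omega> 1) \<sigma> \<epsilon>" \<beta>] elim a by simp
    qed
  next
    case (9 \<sigma> a \<beta> \<epsilon> t)
    have amp: "f 1 = lam 1 * \<omega> 1 * a" and s: "sin \<beta> = - 1" by (fact maxD[OF 9])+
    \<comment> \<open>With cos \<beta> = 0 and sin \<beta> = -1, the addition theorem turns the
      shifted cosine into a sine.\<close>
    show ?case unfolding a_eq[OF amp] stationary_approx_def by (simp add: cos_add cos0[OF s] s)
  next
    case (10 \<sigma> a \<beta> y0 v0)
    have amp: "f 1 = lam 1 * \<omega> 1 * a" and s: "sin \<beta> = - 1" and \<sigma>: "\<sigma> = 3 * dt * a\<^sup>2 / (8 * \<omega> 1)"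
      by (fact maxD[OF 10(1)])+
    show ?case
    proof (rule forced_response)
      show "1 \<le> n" using n by simp
      show "\<omega> k > 0" if "k \<in> {1..n}" for k using that by (rule \<omega>)
      show "int_independent (\<omega> k) (\<omega> 1)" if "k \<in> {2..n}" for k
        using \<open>\<forall>k\<in>{2..n}. int_independent (\<omega> k) (\<omega> 1)\<close> that by blast
      show "\<sigma> = 3 * (d * h 1 ^ 4) * a\<^sup>2 / (8 * \<omega> 1)" unfolding \<sigma> dt_def h_def ..
      show "f 1 = lam 1 * \<omega> 1 * a" "lam 1 > 0" "sin \<beta> = - 1" "cos \<beta> = 0"
        "stationary_initial_data n (\<omega> 1) a \<beta> y0 v0"
        by (fact amp l1 s cos0[OF s] 10(2))+
    qed
  qed
qed

end
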